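(* Let $|\psi\rangle_{AB}$ be a bipartite pure state on finite-dimensional systems $AB$ with Schmidt coefficients $(u_j)_{j=1,\dots,r}$. Then $$\overline{\gamma}_{\mathrm{SEP}}(|\psi\rangle\langle\psi|_{AB})=1+R_{\mathrm{SEP}}(|\psi\rangle\langle\psi|_{AB})=\Big(\sum_{j} u_j\Big)^2=2^{H_{1/2}(\mathrm{tr}_B[|\psi\rangle\langle\psi|_{AB}])}.$$
   Context: $\mathrm{SEP}(A;B)$ is the set of separable states, i.e. finite convex combinations of product states $\rho_A\otimes\sigma_B$. For a Hermitian operator $\omega$ on $AB$, the quasiprobability extent is $\gamma_{\mathrm{SEP}}(\omega)=\inf\{\sum_{i=1}^m|a_i| : m\ge1,\ \omega=\sum_{i=1}^m a_i\tau_i,\ \tau_i\in\mathrm{SEP}(A;B),\ a_i\in\mathbb{R}\}$. The regularized quasiprobability extent is $\overline\gamma_{\mathrm{SEP}}(\omega)=\lim_{n\to\infty}\gamma_{\mathrm{SEP}}(\omega^{\otimes n})^{1/n}$, where $\omega^{\otimes n}$ is viewed as bipartite between $A^{\otimes n}$ and $B^{\otimes n}$. The robustness of entanglement of a state $\rho$ is $R_{\mathrm{SEP}}(\rho)=\min\{t\ge0 : \frac{\rho+t\sigma}{1+t}\in\mathrm{SEP}(A;B)\text{ for some }\sigma\in\mathrm{SEP}(A;B)\}$. The quantum Rényi entropy of order $\alpha$ is $H_\alpha(\rho)=\frac{1}{1-\alpha}\log_2\mathrm{tr}[\rho^\alpha]$. Schmidt coefficients are the $u_j>0$ in $|\psi\rangle=\sum_j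 u_j|f_j\rangle\otimes|g_j\rangle$ with $(f_j)$, $(g_j)$ orthonormal. *)

theory Defs
  imports Complex_Main "HOL-Library.Nonpos_Ints"
begin

text \<open>
  The dimensions of the systems vary with the number of copies inside a single statement, so
  they cannot be encoded in types. A system is a finite set \<open>I\<close> of basis labels, with Hilbert
  space \<open>\<complex>\<^sup>I\<close>. Vectors and operators are coordinate functions on the whole label type that
  vanish off \<open>I\<close> (resp. \<open>I \<times> I\<close>), so that HOL equality is equality of vectors (operators).
  A bipartite system has labels \<open>A \<times> B\<close>.
\<close>

type_synonym 'i ket = "'i \<Rightarrow> complex"
type_synonym 'i oper = "'i \<Rightarrow> 'i \<Rightarrow> complex"

definition is_ket :: "'i set \<Rightarrow> 'i ket \<Rightarrow> bool" where
  "is_ket I v \<longleftrightarrow> (\<forall>x. x \<notin> I \<longrightarrow> v x = 0)"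

definition is_oper :: "'i set \<Rightarrow> 'i oper \<Rightarrow> bool" where
  "is_oper I M \<longleftrightarrow> (\<forall>x y. x \<notin> I \<or> y \<notin> I \<longrightarrow> M x y = 0)"

definition braket :: "'i set \<Rightarrow> 'i ket \<Rightarrow> 'i ket \<Rightarrow> complex" where
  "braket I v w = (\<Sum>x\<in>I. cnj (v x) * w x)"

definition ketbra :: "'i ket \<Rightarrow> 'i oper" where
  "ketbra v = (\<lambda>x y. v x * cnj (v y))"

definition orthonormal_family :: "'i set \<Rightarrow> nat set \<Rightarrow> (nat \<Rightarrow> 'i ket) \<Rightarrow> bool" where
  "orthonormal_family I K v \<longleftrightarrow>
     (\<forall>k\<in>K. is_ket I (v k)) \<and>
     (\<forall>j\<in>K. \<forall>k\<in>K. braket I (v j) (v k) = (if j = k then 1 else 0))"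

definition pure_state :: "'i set \<Rightarrow> 'i ket \<Rightarrow> bool" where
  "pure_state I v \<longleftrightarrow> is_ket I v \<and> braket I v v = 1"

definition op_trace :: "'i set \<Rightarrow> 'i oper \<Rightarrow> complex" where
  "op_trace I M = (\<Sum>x\<in>I. M x x)"

text \<open>Hermiticity is implied: all values of the complex quadratic form are real.\<close>

definition pos_semidef :: "'i set \<Rightarrow> 'i oper \<Rightarrow> bool" where
  "pos_semidef I M \<longleftrightarrow>
     (\<forall>v. (\<Sum>x\<in>I. \<Sum>y\<in>I. cnj (v x) * M x y * v y) \<in> \<real>\<^sub>\<ge>\<^sub>0)"

definition density_op :: "'i set \<Rightarrow> 'i oper \<Rightarrow> bool" where
  "density_op I \<rho> \<longleftrightarrow> is_oper I \<rho> \<and> pos_semidef I \<rho> \<and> op_trace I \<rho> = 1"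

definition op_tensor :: "'a oper \<Rightarrow> 'b oper \<Rightarrow> ('a \<times> 'b) oper" where
  "op_tensor M N = (\<lambda>(a, b) (a', b'). M a a' * N b b')"

definition ptrace_B :: "'b set \<Rightarrow> ('a \<times> 'b) oper \<Rightarrow> 'a oper" where
  "ptrace_B B M = (\<lambda>a a'. \<Sum>b\<in>B. M (a, b) (a', b))"

definition SEP :: "'a set \<Rightarrow> 'b set \<Rightarrow> ('a \<times> 'b) oper set" where
  "SEP A B = {\<omega>. \<exists>(m::nat) (p :: nat \<Rightarrow> real) \<rho> \<sigma>.
     (\<forall>i\<in>{1..m}. 0 \<le> p i \<and> density_op A (\<rho> i) \<and> density_op B (\<sigma> i)) \<and>
     (\<Sum>i=1..m. p i) = 1 \<and>
     \<omega> = (\<lambda>x y. \<Sum>i=1..m. of_real (p i) * op_tensor (\<rho> i) (\<sigma> i) x y)}"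

text \<open>
  For Hermitian \<open>\<omega>\<close> on nonempty finite systems the set below is nonempty (product states span
  the Hermitian operators) and bounded below by 0, so the real infimum is the intended one.
\<close>

definition qp_extent :: "'a set \<Rightarrow> 'b set \<Rightarrow> ('a \<times> 'b) oper \<Rightarrow> real" where
  "qp_extent A B \<omega> = Inf {s. \<exists>(m::nat) (a :: nat \<Rightarrow> real) \<tau>.
     m \<ge> 1 \<and> (\<forall>i\<in>{1..m}. \<tau> i \<in> SEP A B) \<and>
     \<omega> = (\<lambda>x y. \<Sum>i=1..m. of_real (a i) * \<tau> i x y) \<and>
     s = (\<Sum>i=1..m. \<bar>a i\<bar>)}"

definition power_system :: "nat \<Rightarrow> 'i set \<Rightarrow> 'i list set" where
  "power_system n I = {xs. length xs = n \<and> set xs \<subseteq> I}"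

text \<open>
  The labels of \<open>n\<close> copies of \<open>AB\<close> are already regrouped here: the \<open>i\<close>-th copy carries the
  label \<open>(xs ! i, ys ! i)\<close>, where \<open>xs\<close> labels all copies of \<open>A\<close> and \<open>ys\<close> all copies of \<open>B\<close>.
\<close>

definition bip_tensor_power :: "nat \<Rightarrow> ('a \<times> 'b) oper \<Rightarrow> ('a list \<times> 'b list) oper" where
  "bip_tensor_power n \<omega> = (\<lambda>(xs, ys) (xs', ys').
     if length xs = n \<and> length ys = n \<and> length xs' = n \<and> length ys' = n
     then \<Prod>i<n. \<omega> (xs ! i, ys ! i) (xs' ! i, ys' ! i) else 0)"

definition qp_extent_rate :: "'a set \<Rightarrow> 'b set \<Rightarrow> ('a \<times> 'b) oper \<Rightarrow> nat \<Rightarrow> real" where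
  "qp_extent_rate A B \<omega> n =
     root n (qp_extent (power_system n A) (power_system n B) (bip_tensor_power n \<omega>))"

definition reg_qp_extent :: "'a set \<Rightarrow> 'b set \<Rightarrow> ('a \<times> 'b) oper \<Rightarrow> real" where
  "reg_qp_extent A B \<omega> = lim (qp_extent_rate A B \<omega>)"

definition robustness_feasible :: "'a set \<Rightarrow> 'b set \<Rightarrow> ('a \<times> 'b) oper \<Rightarrow> real \<Rightarrow> bool" where
  "robustness_feasible A B \<rho> t \<longleftrightarrow> t \<ge> 0 \<and>
     (\<exists>\<sigma>\<in>SEP A B. (\<lambda>x y. (\<rho> x y + of_real t * \<sigma> x y) / of_real (1 + t)) \<in> SEP A B)"

definition robustness :: "'a set \<Rightarrow> 'b set \<Rightarrow> ('a \<times> 'b) oper \<Rightarrow> real" where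
  "robustness A B \<rho> = (LEAST t. robustness_feasible A B \<rho> t)"

text \<open>
  Real power of a positive semidefinite operator via its spectral decomposition, where only the
  positive eigenvalues are listed (the power is taken on the support). For \<open>\<alpha> > 0\<close> this is
  the usual functional calculus with \<open>0\<^sup>\<alpha> = 0\<close>.
\<close>

definition op_powr :: "'i set \<Rightarrow> 'i oper \<Rightarrow> real \<Rightarrow> 'i oper" where
  "op_powr I M \<alpha> = (THE X. \<exists>(m::nat) (l :: nat \<Rightarrow> real) v.
     orthonormal_family I {1..m} v \<and> (\<forall>k\<in>{1..m}. l k > 0) \<and>
     M = (\<lambda>x y. \<Sum>k=1..m. of_real (l k) * ketbra (v k) x y) \<and>
     X = (\<lambda>x y. \<Sum>k=1..m. of_real (l k powr \<alpha>) * ketbra (v k) x y))"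

definition renyi_entropy :: "'i set \<Rightarrow> real \<Rightarrow> 'i oper \<Rightarrow> real" where
  "renyi_entropy I \<alpha> \<rho> = 1 / (1 - \<alpha>) * log 2 (Re (op_trace I (op_powr I \<rho> \<alpha>)))"

definition schmidt_coefficients ::
  "'a set \<Rightarrow> 'b set \<Rightarrow> ('a \<times> 'b) ket \<Rightarrow> nat \<Rightarrow> (nat \<Rightarrow> real) \<Rightarrow> bool" where
  "schmidt_coefficients A B \<psi> r u \<longleftrightarrow> (\<exists>f g.
     orthonormal_family A {1..r} f \<and> orthonormal_family B {1..r} g \<and>
     (\<forall>j\<in>{1..r}. u j > 0) \<and>
     \<psi> = (\<lambda>(a, b). \<Sum>j=1..r. of_real (u j) * f j a * g j b))"

end

theory Submission
  imports Defs "HOL-Analysis.L2_Norm" "HOL-Library.Real_Mod"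
begin

text \<open>
  With \<open>S = \<Sum>\<^sub>j u\<^sub>j\<close>, the single-copy extent is exactly \<open>2 S\<^sup>2 - 1\<close> and the robustness is \<open>S\<^sup>2 - 1\<close>.
  For the lower bounds, the vector \<open>\<Phi> = \<Sum>\<^sub>j f\<^sub>j \<otimes> g\<^sub>j\<close> satisfies \<open>0 \<le> \<langle>\<Phi>|\<tau>|\<Phi>\<rangle> \<le> 1\<close> on separable states
  (Cauchy--Schwarz and Bessel) but \<open>|\<langle>\<Phi>|\<psi>\<rangle>|\<^sup>2 = S\<^sup>2\<close>, so the positive weights of any quasiprobability
  decomposition add up to at least \<open>S\<^sup>2\<close>. For the upper bounds, averaging the product vectors
  \<open>(\<Sum>\<^sub>j \<surd>u\<^sub>j z\<^sub>j f\<^sub>j) \<otimes> (\<Sum>\<^sub>j \<surd>u\<^sub>j z\<^sub>j\<^sup>* g\<^sub>j)\<close> over suitable phases \<open>z\<close> shows that \<open>|\<psi>\<rangle>\<langle>\<psi>|\<close> plus the diagonal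
  operator \<open>\<Sum>\<^sub>j\<^sub>\<noteq>\<^sub>l u\<^sub>j u\<^sub>l |f\<^sub>j g\<^sub>l\<rangle>\<langle>f\<^sub>j g\<^sub>l|\<close> of trace \<open>S\<^sup>2 - 1\<close> is \<open>S\<^sup>2\<close> times a separable state. The \<open>n\<close>-copy
  state has Schmidt coefficients \<open>u\<^sub>j\<^sub>1 \<cdots> u\<^sub>j\<^sub>n\<close> summing to \<open>S\<^sup>n\<close>, and the \<open>n\<close>-th root of
  \<open>2 S\<^sup>2\<^sup>n - 1\<close> tends to \<open>S\<^sup>2\<close>.
\<close>

section \<open>Brakets, orthonormal families and quadratic forms\<close>

text \<open>The same notion as \<open>orthonormal_family\<close> over an arbitrary index type: the
  Schmidt indices of \<open>n\<close> copies are lists.\<close>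

definition orthonormal_on :: "'i set \<Rightarrow> 'k set \<Rightarrow> ('k \<Rightarrow> 'i ket) \<Rightarrow> bool" where
  "orthonormal_on I K v \<longleftrightarrow>
     (\<forall>k\<in>K. is_ket I (v k)) \<and>
     (\<forall>j\<in>K. \<forall>k\<in>K. braket I (v j) (v k) = (if j = k then 1 else 0))"

definition quad_form :: "'i set \<Rightarrow> 'i oper \<Rightarrow> 'i ket \<Rightarrow> complex" where
  "quad_form I M v = (\<Sum>x\<in>I. \<Sum>y\<in>I. cnj (v x) * M x y * v y)"

definition ket_tensor :: "'a ket \<Rightarrow> 'b ket \<Rightarrow> ('a \<times> 'b) ket" where
  "ket_tensor v w = (\<lambda>(a, b). v a * w b)"

lemma orthonormal_onD:
  assumes "orthonormal_on I K v"
  shows "k \<in> K \<Longrightarrow> is_ket I (v k)"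
    and "j \<in> K \<Longrightarrow> k \<in> K \<Longrightarrow> braket I (v j) (v k) = (if j = k then 1 else 0)"
  using assms by (auto simp: orthonormal_on_def)

lemma mult_cnj_cmod: "z * cnj z = (of_real (cmod z))\<^sup>2"
  by (metis complex_norm_square of_real_power)

lemma braket_commute: "braket I v w = cnj (braket I w v)"
  by (simp add: braket_def mult.commute)

lemma braket_sum_right: "braket I v (\<lambda>x. \<Sum>k\<in>K. c k * w k x) = (\<Sum>k\<in>K. c k * braket I v (w k))"
  unfolding braket_def sum_distrib_left by (subst sum.swap) (simp add: ac_simps)

lemma braket_sum_left: "braket I (\<lambda>x. \<Sum>k\<in>K. c k * w k x) v = (\<Sum>k\<in>K. cnj (c k) * braket I (w k) v)"
  by (subst braket_commute) (simp add: braket_sum_right braket_commute[of I v])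

lemma braket_diff_right: "braket I v (\<lambda>x. w x - w' x) = braket I v w - braket I v w'"
  by (simp add: braket_def right_diff_distrib sum_subtractf)

lemma braket_diff_left: "braket I (\<lambda>x. w x - w' x) v = braket I w v - braket I w' v"
  by (simp add: braket_def left_diff_distrib sum_subtractf)

lemma braket_self: "braket I v v = of_real (\<Sum>x\<in>I. (cmod (v x))\<^sup>2)"
  by (simp add: braket_def mult_cnj_cmod mult.commute)

lemma braket_self_nonneg: "0 \<le> Re (braket I v v)"
  by (simp add: braket_self sum_nonneg)

lemma braket_ket_tensor:
  "braket (A \<times> B) (ket_tensor v w) (ket_tensor v' w') = braket A v v' * braket B w w'"
  by (simp add: braket_def ket_tensor_def sum_product sum.cartesian_product split_def ac_simps)

lemma braket_orthonormal_sum: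
  assumes "orthonormal_on I K f" "finite K"
  shows "braket I (\<lambda>x. \<Sum>k\<in>K. c k * f k x) (\<lambda>x. \<Sum>k\<in>K. d k * f k x) = (\<Sum>k\<in>K. cnj (c k) * d k)"
proof -
  have "braket I (\<lambda>x. \<Sum>k\<in>K. c k * f k x) (\<lambda>x. \<Sum>k\<in>K. d k * f k x) =
      (\<Sum>j\<in>K. cnj (c j) * (\<Sum>k\<in>K. d k * braket I (f j) (f k)))"
    by (simp add: braket_sum_left braket_sum_right)
  also have "\<dots> = (\<Sum>j\<in>K. cnj (c j) * (\<Sum>k\<in>K. if k = j then d k else 0))"
    using orthonormal_onD(2)[OF assms(1)] by (intro sum.cong refl arg_cong2[where f = "(*)"]) auto
  also have "\<dots> = (\<Sum>k\<in>K. cnj (c k) * d k)"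
    using assms(2) by simp
  finally show ?thesis .
qed

lemma braket_orthonormal_coeff:
  assumes "orthonormal_on I K f" "finite K" "k \<in> K"
  shows "braket I (f k) (\<lambda>x. \<Sum>j\<in>K. c j * f j x) = c k"
proof -
  have "braket I (f k) (\<lambda>x. \<Sum>j\<in>K. c j * f j x) = (\<Sum>j\<in>K. if j = k then c j else 0)"
    unfolding braket_sum_right
    using orthonormal_onD(2)[OF assms(1)] assms(3) by (intro sum.cong refl) auto
  with assms show ?thesis by simp
qed

text \<open>The residual of \<open>v\<close> after subtracting its projection \<open>p\<close> has
  nonnegative squared norm, and this norm is the difference of the two sides.\<close>

lemma bessel:
  assumes "orthonormal_on I K f" "finite K"
  shows "(\<Sum>k\<in>K. (cmod (braket I (f k) v))\<^sup>2) \<le> Re (braket I v v)"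
proof -
  define c where "c k = braket I (f k) v" for k
  define p where "p = (\<lambda>x. \<Sum>k\<in>K. c k * f k x)"
  have pv: "braket I p v = (\<Sum>k\<in>K. cnj (c k) * c k)"
    by (simp add: p_def braket_sum_left c_def)
  have pp: "braket I p p = (\<Sum>k\<in>K. cnj (c k) * c k)"
    unfolding p_def by (rule braket_orthonormal_sum[OF assms])
  have vp: "braket I v p = (\<Sum>k\<in>K. cnj (c k) * c k)"
    by (subst braket_commute) (simp add: pv mult.commute)
  have "0 \<le> Re (braket I (\<lambda>x. v x - p x) (\<lambda>x. v x - p x))"
    by (rule braket_self_nonneg)
  also have "\<dots> = Re (braket I v v) - Re (\<Sum>k\<in>K. cnj (c k) * c k)"
    by (simp add: braket_diff_left braket_diff_right pv pp vp)
  also have "(\<Sum>k\<in>K. cnj (c k) * c k) = of_real (\<Sum>k\<in>K. (cmod (c k))\<^sup>2)"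
    by (simp add: mult_cnj_cmod mult.commute)
  finally show ?thesis by (simp add: c_def)
qed

section \<open>Quadratic forms and rank-one decompositions of positive semidefinite
  operators\<close>

lemma quad_form_sum:
  "quad_form I (\<lambda>x y. \<Sum>k\<in>K. c k * M k x y) v = (\<Sum>k\<in>K. c k * quad_form I (M k) v)"
proof -
  have "quad_form I (\<lambda>x y. \<Sum>k\<in>K. c k * M k x y) v =
      (\<Sum>x\<in>I. \<Sum>k\<in>K. \<Sum>y\<in>I. c k * (cnj (v x) * M k x y * v y))"
    unfolding quad_form_def sum_distrib_left sum_distrib_right
    by (intro sum.cong refl, subst sum.swap) (simp add: ac_simps)
  also have "\<dots> = (\<Sum>k\<in>K. c k * quad_form I (M k) v)"
    unfolding quad_form_def sum_distrib_left by (subst sum.swap) simp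
  finally show ?thesis .
qed

lemma quad_form_ketbra: "quad_form I (ketbra w) v = of_real ((cmod (braket I v w))\<^sup>2)"
proof -
  have "quad_form I (ketbra w) v = braket I v w * cnj (braket I v w)"
    unfolding quad_form_def ketbra_def braket_def cnj_sum sum_product
    by (intro sum.cong refl) simp
  then show ?thesis by (simp only: complex_norm_square)
qed

lemma pos_semidef_iff: "pos_semidef I M \<longleftrightarrow> (\<forall>v. 0 \<le> Re (quad_form I M v) \<and> Im (quad_form I M v) = 0)"
  by (simp add: pos_semidef_def quad_form_def complex_nonneg_Reals_iff)

lemma quad_form_cong:
  assumes "\<And>x y. x \<in> I \<Longrightarrow> y \<in> I \<Longrightarrow> M x y = N x y" "\<And>x. x \<in> I \<Longrightarrow> v x = w x"
  shows "quad_form I M v = quad_form I N w"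
  unfolding quad_form_def using assms by (intro sum.cong refl) auto

lemma quad_form_insert:
  assumes "finite I" "x \<notin> I"
  shows "quad_form (insert x I) M v = cnj (v x) * M x x * v x + cnj (v x) * (\<Sum>y\<in>I. M x y * v y)
    + (\<Sum>y\<in>I. cnj (v y) * M y x) * v x + quad_form I M v"
  using assms by (simp add: quad_form_def sum.distrib sum_distrib_left sum_distrib_right algebra_simps)

text \<open>Test vectors are extended by zero. Applied to one- and two-element index sets, this
  turns positivity into statements about single entries.\<close>

lemma pos_semidef_subset:
  assumes "pos_semidef I M" "J \<subseteq> I" "finite I"
  shows "pos_semidef J M"
  unfolding pos_semidef_iff
proof
  fix v
  define w :: "'a ket" where "w x = (if x \<in> J then v x else 0)" for x
  have "quad_form I M w = quad_form J M w"
    unfolding quad_form_def using assms(2,3)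
    by (intro sum.mono_neutral_cong_right) (auto simp: w_def intro!: sum.neutral sum.mono_neutral_cong_right)
  also have "\<dots> = quad_form J M v"
    by (rule quad_form_cong) (auto simp: w_def)
  finally show "0 \<le> Re (quad_form J M v) \<and> Im (quad_form J M v) = 0"
    using assms(1) unfolding pos_semidef_iff by metis
qed

text \<open>Polarization on two coordinates: the form is real at \<open>(1, 1)\<close> and at
  \<open>(1, i)\<close>, which settles the imaginary and the real parts of the off-diagonal
  entries.\<close>

lemma pos_semidef_hermitian:
  assumes "pos_semidef I M" "finite I" "x \<in> I" "y \<in> I"
  shows "M y x = cnj (M x y)"
proof -
  have diag: "Im (M z z) = 0" if "z \<in> I" for z
  proof -
    have "pos_semidef {z} M" using assms that by (auto intro: pos_semidef_subset)
    from this[unfolded pos_semidef_iff, rule_format, of "\<lambda>_. 1"]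
    show ?thesis by (simp add: quad_form_def)
  qed
  show ?thesis
  proof (cases "x = y")
    case True
    then show ?thesis using diag[of x] assms by (simp add: complex_eq_iff)
  next
    case False
    have psd: "pos_semidef {x, y} M" using assms by (auto intro: pos_semidef_subset)
    from psd[unfolded pos_semidef_iff, rule_format, of "\<lambda>_. 1"]
    have "Im (M x y) + Im (M y x) = 0"
      using False diag assms by (simp add: quad_form_def)
    moreover from psd[unfolded pos_semidef_iff, rule_format, of "\<lambda>z. if z = x then 1 else \<i>"]
    have "Re (M x y) = Re (M y x)"
      using False diag assms by (simp add: quad_form_def)
    ultimately show ?thesis by (simp add: complex_eq_iff)
  qed
qed

text \<open>One step of the Cholesky algorithm: split off the row and column of \<open>x\<close>, so that the Schur
  complement of the pivot remains.\<close>

lemma pos_semidef_schur_complement: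
  assumes "pos_semidef (insert x I) M" "finite I" "x \<notin> I" "M x x \<noteq> 0"
  shows "pos_semidef I (\<lambda>y z. M y z - M y x * M x z / M x x)"
  unfolding pos_semidef_iff
proof
  fix v
  define N where "N = (\<lambda>y z. M y z - M y x * M x z / M x x)"
  define s where "s = (\<Sum>y\<in>I. M x y * v y)"
  \<comment> \<open>This value of the coordinate at \<open>x\<close> completes the square; what
    remains of the form is that of the Schur complement at \<open>v\<close>.\<close>
  define c where "c = - s / M x x"
  define w where "w = v(x := c)"
  have row: "(\<Sum>y\<in>I. M x y * w y) = s"
    unfolding s_def using assms(3) by (intro sum.cong refl) (auto simp: w_def)
  have herm: "M y x = cnj (M x y)" if "y \<in> I" for y
    using pos_semidef_hermitian[OF assms(1), of x y] assms(2) that by simp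
  have col: "(\<Sum>y\<in>I. cnj (w y) * M y x) = cnj s"
    unfolding s_def cnj_sum using assms(3) herm
    by (intro sum.cong refl) (auto simp: w_def)
  have quad: "quad_form I M w = quad_form I M v"
    using assms(3) by (intro quad_form_cong) (auto simp: w_def)
  have "quad_form (insert x I) M w = cnj c * M x x * c + cnj c * s + cnj s * c + quad_form I M v"
    using assms(2,3) by (simp add: quad_form_insert row col quad) (simp add: w_def)
  also have "\<dots> = quad_form I M v - cnj s * s / M x x"
    using assms(4) by (simp add: c_def field_simps)
  also have "cnj s * s / M x x = (\<Sum>y\<in>I. \<Sum>z\<in>I. cnj (v y) * (M y x * M x z / M x x) * v z)"
  proof -
    have "cnj s = (\<Sum>y\<in>I. cnj (v y) * M y x)"
      unfolding s_def cnj_sum using herm by (intro sum.cong refl) auto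
    then have "cnj s * s / M x x = (\<Sum>y\<in>I. \<Sum>z\<in>I. cnj (v y) * M y x * (M x z * v z) / M x x)"
      by (simp add: s_def sum_product sum_divide_distrib)
    then show ?thesis by (simp add: ac_simps)
  qed
  also have "quad_form I M v - \<dots> = quad_form I N v"
    by (simp add: quad_form_def N_def sum_subtractf[symmetric] algebra_simps)
  finally have "quad_form I N v = quad_form (insert x I) M w" by simp
  then show "0 \<le> Re (quad_form I (\<lambda>y z. M y z - M y x * M x z / M x x) v) \<and>
      Im (quad_form I (\<lambda>y z. M y z - M y x * M x z / M x x) v) = 0"
    using assms(1) by (simp add: pos_semidef_iff N_def)
qed

text \<open>With a zero on the diagonal, the form at the vector \<open>(- t m, 1)\<close> is affine
  in \<open>t\<close> with slope \<open>- 2 |m|^2\<close>, so it would become negative unless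
  \<open>m = 0\<close>.\<close>

lemma pos_semidef_zero_diagonal:
  assumes "pos_semidef I M" "finite I" "x \<in> I" "M x x = 0" "y \<in> I"
  shows "M x y = 0"
proof (cases "y = x")
  case False
  define m where "m = M x y"
  have herm: "M y x = cnj m"
    using pos_semidef_hermitian[OF assms(1,2,3,5)] by (simp add: m_def)
  have "pos_semidef {x, y} M" using assms by (auto intro: pos_semidef_subset)
  then have "0 \<le> Re (quad_form {x, y} M (\<lambda>z. if z = x then - of_real t * m else 1))" for t
    unfolding pos_semidef_iff by blast
  then have le: "2 * t * (cmod m)\<^sup>2 \<le> Re (M y y)" for t
    using False assms(4) unfolding cmod_power2
    by (simp add: quad_form_def herm m_def[symmetric] power2_eq_square algebra_simps)
  have "(cmod m)\<^sup>2 = 0"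
  proof (rule ccontr)
    assume "(cmod m)\<^sup>2 \<noteq> 0"
    \<comment> \<open>This \<open>t\<close> makes the left side of \<open>le\<close> equal to
      \<open>Re (M y y) + 1\<close>.\<close>
    then show False
      using le[of "(Re (M y y) + 1) / (2 * (cmod m)\<^sup>2)"] by simp
  qed
  then show ?thesis by (simp add: m_def)
qed (use assms in simp)

text \<open>A Cholesky factorization takes the place of the spectral theorem: the vectors may
  overlap, since only a sum of rank-one terms is wanted. The induction removes one row and column at
  a time.\<close>

lemma pos_semidef_decomposition:
  assumes "finite I" "pos_semidef I M"
  shows "\<exists>(m::nat) v. \<forall>x\<in>I. \<forall>y\<in>I. M x y = (\<Sum>i<m. ketbra (v i) x y)"
  using assms
proof (induction I arbitrary: M rule: finite_induct)
  case (insert x I M)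
  define J where "J = insert x I"
  have finJ: "finite J" and psd: "pos_semidef J M" and xJ: "x \<in> J"
    using insert by (auto simp: J_def)
  have herm: "M z y = cnj (M y z)" if "y \<in> J" "z \<in> J" for y z
    using pos_semidef_hermitian[OF psd finJ that] .
  show ?case
  proof (cases "M x x = 0")
    case True
    have "pos_semidef I M" by (rule pos_semidef_subset[OF psd _ finJ]) (auto simp: J_def)
    then obtain m :: nat and v where v: "M y z = (\<Sum>i<m. ketbra (v i) y z)" if "y \<in> I" "z \<in> I" for y z
      using insert.IH by blast
    \<comment> \<open>A zero pivot forces its whole row and column to vanish, so the vectors for
      \<open>I\<close> only have to be set to zero at \<open>x\<close>.\<close>
    have 0: "M x y = 0" "M y x = 0" if "y \<in> J" for y
      using pos_semidef_zero_diagonal[OF psd finJ xJ True that] herm[OF xJ that] by auto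
    have "M y z = (\<Sum>i<m. ketbra ((v i)(x := 0)) y z)" if "y \<in> J" "z \<in> J" for y z
      using that v[of y z] 0 insert.hyps(2)
      by (auto simp: J_def ketbra_def intro!: sum.cong)
    then show ?thesis unfolding J_def by (intro exI[of _ m] exI[of _ "\<lambda>i. (v i)(x := 0)"]) blast
  next
    case False
    obtain m :: nat and v where
      v: "M y z - M y x * M x z / M x x = (\<Sum>i<m. ketbra (v i) y z)" if "y \<in> I" "z \<in> I" for y z
      using insert.IH[OF pos_semidef_schur_complement] psd insert.hyps False unfolding J_def by blast
    have "pos_semidef {x} M" by (rule pos_semidef_subset[OF psd _ finJ]) (use xJ in auto)
    from this[unfolded pos_semidef_iff, rule_format, of "\<lambda>_. 1"]
    have "0 \<le> Re (M x x)" by (simp add: quad_form_def)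
    moreover have "Im (M x x) = 0" using herm[OF xJ xJ] by (simp add: complex_eq_iff)
    ultimately obtain p where p: "M x x = of_real p" "p > 0"
      using False by (metis complex_eq_iff Im_complex_of_real Re_complex_of_real less_eq_real_def of_real_0)
    \<comment> \<open>The pivot column scaled by the root of the pivot: \<open>ketbra w\<close>
      restores exactly what the Schur complement subtracts.\<close>
    define w where "w y = M y x / of_real (sqrt p)" for y
    have ww: "w y * cnj (w z) = M y x * M x z / M x x" if "z \<in> J" for y z
    proof -
      have "cnj (M z x) = M x z" using herm[OF that xJ] by simp
      moreover have "(of_real (sqrt p) :: complex) * of_real (sqrt p) = M x x"
        using p by (simp flip: of_real_mult)
      ultimately show ?thesis by (simp add: w_def)
    qed
    define u where "u i = (if i < m then (v i)(x := 0) else w)" for i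
    have "M y z = (\<Sum>i<Suc m. ketbra (u i) y z)" if "y \<in> J" "z \<in> J" for y z
    proof -
      have "(\<Sum>i<m. ketbra (u i) y z) = M y z - M y x * M x z / M x x"
      proof (cases "y = x \<or> z = x")
        case True
        then show ?thesis using False by (auto simp: u_def ketbra_def)
      next
        case False
        with that have "y \<in> I" "z \<in> I" by (auto simp: J_def)
        from v[OF this] False show ?thesis by (simp add: u_def ketbra_def)
      qed
      moreover have "ketbra (u m) y z = M y x * M x z / M x x"
        using ww[OF that(2)] by (simp add: u_def ketbra_def)
      ultimately show ?thesis by simp
    qed
    then show ?thesis unfolding J_def by blast
  qed
qed auto

section \<open>Separable states\<close>

text \<open>The vectors are not normalized; their squared norms are the mixing weights, and unit
  trace makes these add up to one.\<close>

lemma density_op_decomposition: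
  assumes "finite I" "density_op I \<rho>"
  obtains m :: nat and v where "\<And>x y. x \<in> I \<Longrightarrow> y \<in> I \<Longrightarrow> \<rho> x y = (\<Sum>i<m. ketbra (v i) x y)"
    and "(\<Sum>i<m. Re (braket I (v i) (v i))) = 1"
proof -
  obtain m :: nat and v where v: "\<And>x y. x \<in> I \<Longrightarrow> y \<in> I \<Longrightarrow> \<rho> x y = (\<Sum>i<m. ketbra (v i) x y)"
    using pos_semidef_decomposition[OF assms(1)] assms(2) unfolding density_op_def by blast
  have "(\<Sum>i<m. braket I (v i) (v i)) = (\<Sum>x\<in>I. \<Sum>i<m. ketbra (v i) x x)"
    by (subst sum.swap) (simp add: braket_def ketbra_def mult.commute)
  also have "\<dots> = op_trace I \<rho>"
    by (simp add: op_trace_def v)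
  finally have "(\<Sum>i<m. braket I (v i) (v i)) = 1"
    using assms(2) by (simp add: density_op_def)
  then have "(\<Sum>i<m. Re (braket I (v i) (v i))) = 1"
    by (metis Re_sum one_complex.simps(1))
  with v that show ?thesis by blast
qed

lemma density_op_ketbra:
  assumes "is_ket I v" "braket I v v = 1"
  shows "density_op I (ketbra v)"
proof -
  have "op_trace I (ketbra v) = braket I v v"
    by (simp add: op_trace_def ketbra_def braket_def mult.commute)
  with assms show ?thesis
    unfolding density_op_def pos_semidef_iff quad_form_ketbra
    by (auto simp: is_oper_def is_ket_def ketbra_def)
qed

lemma is_ket_sum:
  assumes "\<And>k. k \<in> K \<Longrightarrow> is_ket I (f k)"
  shows "is_ket I (\<lambda>x. \<Sum>k\<in>K. c k * f k x)"
  using assms by (auto simp: is_ket_def intro!: sum.neutral)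

text \<open>\<open>SEP\<close> insists on indices \<open>1..m\<close>. Reindexing once allows
  mixtures over phases and over pairs of Schmidt indices.\<close>

lemma SEP_convex_combination:
  assumes "finite X" "(\<Sum>i\<in>X. p i) = 1"
    and "\<And>i. i \<in> X \<Longrightarrow> 0 \<le> p i" "\<And>i. i \<in> X \<Longrightarrow> density_op A (\<rho> i)" "\<And>i. i \<in> X \<Longrightarrow> density_op B (\<sigma> i)"
  shows "(\<lambda>x y. \<Sum>i\<in>X. of_real (p i) * op_tensor (\<rho> i) (\<sigma> i) x y) \<in> SEP A B"
proof -
  obtain h where h: "bij_betw h {1..card X} X"
    using ex_bij_betw_nat_finite_1[OF assms(1)] by blast
  have hX: "h i \<in> X" if "i \<in> {1..card X}" for i
    using bij_betwE[OF h] that by blast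
  have "(\<Sum>i=1..card X. p (h i)) = 1"
    using sum.reindex_bij_betw[OF h] assms(2) by metis
  moreover have "(\<lambda>x y. \<Sum>i\<in>X. of_real (p i) * op_tensor (\<rho> i) (\<sigma> i) x y) =
      (\<lambda>x y. \<Sum>i=1..card X. of_real (p (h i)) * op_tensor (\<rho> (h i)) (\<sigma> (h i)) x y)"
    by (intro ext sum.reindex_bij_betw[OF h, symmetric])
  moreover have "\<forall>i\<in>{1..card X}. 0 \<le> p (h i) \<and> density_op A (\<rho> (h i)) \<and> density_op B (\<sigma> (h i))"
    using assms hX by blast
  ultimately show ?thesis
    unfolding SEP_def mem_Collect_eq
    by (intro exI[of _ "card X"] exI[of _ "\<lambda>i. p (h i)"] exI[of _ "\<lambda>i. \<rho> (h i)"] exI[of _ "\<lambda>i. \<sigma> (h i)"]) auto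
qed

lemma op_trace_sum:
  "op_trace I (\<lambda>x y. \<Sum>k\<in>K. c k * M k x y) = (\<Sum>k\<in>K. c k * op_trace I (M k))"
  unfolding op_trace_def sum_distrib_left by (rule sum.swap)

lemma op_trace_op_tensor: "op_trace (A \<times> B) (op_tensor M N) = op_trace A M * op_trace B N"
  by (simp add: op_trace_def op_tensor_def sum_product sum.cartesian_product split_def)

lemma op_trace_SEP:
  assumes "\<tau> \<in> SEP A B"
  shows "op_trace (A \<times> B) \<tau> = 1"
proof -
  obtain m :: nat and p \<rho> \<sigma> where *:
    "\<forall>i\<in>{1..m}. 0 \<le> p i \<and> density_op A (\<rho> i) \<and> density_op B (\<sigma> i)" "(\<Sum>i=1..m. p i) = 1"
    "\<tau> = (\<lambda>x y. \<Sum>i=1..m. of_real (p i) * op_tensor (\<rho> i) (\<sigma> i) x y)"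
    using assms unfolding SEP_def by blast
  have "op_trace (A \<times> B) \<tau> = (\<Sum>i=1..m. of_real (p i))"
    using *(1) unfolding *(3) op_trace_sum op_trace_op_tensor density_op_def by (intro sum.cong) auto
  also have "\<dots> = of_real (\<Sum>i=1..m. p i)" by simp
  finally show ?thesis by (simp only: *(2) of_real_1)
qed

text \<open>Cauchy--Schwarz without conjugates, reduced to the real inequality for the
  moduli.\<close>

lemma sum_cmod_mult_squared_le:
  fixes x y :: "'k \<Rightarrow> complex"
  shows "(cmod (\<Sum>k\<in>K. x k * y k))\<^sup>2 \<le> (\<Sum>k\<in>K. (cmod (x k))\<^sup>2) * (\<Sum>k\<in>K. (cmod (y k))\<^sup>2)"
proof -
  have "cmod (\<Sum>k\<in>K. x k * y k) \<le> (\<Sum>k\<in>K. \<bar>cmod (x k)\<bar> * \<bar>cmod (y k)\<bar>)"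
    using norm_sum[of "\<lambda>k. x k * y k" K] by (simp add: norm_mult)
  also have "\<dots> \<le> L2_set (\<lambda>k. cmod (x k)) K * L2_set (\<lambda>k. cmod (y k)) K"
    by (rule L2_set_mult_ineq)
  finally have "(cmod (\<Sum>k\<in>K. x k * y k))\<^sup>2 \<le> (L2_set (\<lambda>k. cmod (x k)) K * L2_set (\<lambda>k. cmod (y k)) K)\<^sup>2"
    by (intro power_mono) auto
  then show ?thesis
    by (simp add: power_mult_distrib L2_set_def sum_nonneg)
qed

section \<open>Phase averages\<close>

text \<open>After ordering both pairs and dividing by the smallest power, parity decides: either
  \<open>c' = 0\<close>, or the right side is even, which forces \<open>b' = 0\<close> and then the
  impossible \<open>2 ^ c'' + 2 ^ d'' = 1\<close>.\<close>

lemma two_powers_sum_eq: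
  fixes a b c d :: nat
  assumes "(2::nat) ^ a + 2 ^ b = 2 ^ c + 2 ^ d"
  shows "a = c \<and> b = d \<or> a = d \<and> b = c"
proof -
  have *: "a = c \<and> b = d" if "a \<le> b" "c \<le> d" "a \<le> c" "(2::nat) ^ a + 2 ^ b = 2 ^ c + 2 ^ d" for a b c d :: nat
  proof -
    define b' c' d' where "b' = b - a" "c' = c - a" "d' = d - a"
    then have d: "b = a + b'" "c = a + c'" "d = a + d'"
      using that by auto
    have "2 ^ a * ((1::nat) + 2 ^ b') = 2 ^ a * (2 ^ c' + 2 ^ d')"
      using that(4) by (simp add: d power_add distrib_left)
    then have eq: "(1::nat) + 2 ^ b' = 2 ^ c' + 2 ^ d'"
      by (simp only: mult_cancel1) simp
    have "c' \<le> d'" using that(2) d by simp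
    show ?thesis
    proof (cases c')
      case 0
      then show ?thesis using eq d by simp
    next
      case (Suc c'')
      then obtain d'' where "d' = Suc d''" using \<open>c' \<le> d'\<close> by (cases d') auto
      with Suc eq have ev: "(1::nat) + 2 ^ b' = 2 * (2 ^ c'' + 2 ^ d'')" by simp
      then have "b' = 0" by (cases b') (auto, presburger)
      with ev have "(2::nat) ^ c'' + 2 ^ d'' = 1" by simp
      moreover have "(0::nat) < 2 ^ c''" "(0::nat) < 2 ^ d''" by simp_all
      ultimately have False by linarith
      then show ?thesis ..
    qed
  qed
  have min_max: "(2::nat) ^ min x y + 2 ^ max x y = 2 ^ x + 2 ^ y" for x y :: nat
    by (simp add: min_def max_def)
  have "min a b = min c d \<and> max a b = max c d"
  proof (cases "min a b \<le> min c d")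
    case True
    then show ?thesis using assms by (intro *) (auto simp: min_max)
  next
    case False
    then have "min c d = min a b \<and> max c d = max a b" using assms by (intro *) (auto simp: min_max)
    then show ?thesis by simp
  qed
  then show ?thesis by (auto simp: min_def max_def split: if_splits)
qed

text \<open>Orthogonality of characters of the cyclic group of order \<open>N\<close>: a geometric
  sum whose ratio is an \<open>N\<close>-th root of unity. The bound on \<open>d\<close> leaves
  \<open>0\<close> as the only multiple of \<open>N\<close>.\<close>

lemma sum_cis_character:
  fixes d :: int
  assumes "\<bar>d\<bar> < int N"
  shows "(\<Sum>x<N. cis (2 * pi * (real x * of_int d / real N))) = (if d = 0 then of_nat N else 0)"
proof (cases "d = 0")
  case False
  have N: "N > 0" using assms by linarith
  define q where "q = cis (2 * pi * (of_int d / real N))"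
  have "q \<noteq> 1"
  proof
    assume "q = 1"
    then obtain k :: int where "2 * pi * (of_int d / real N) = of_int k * (2 * pi)"
      unfolding q_def cis_eq_1_iff by blast
    then have "(2 * pi) * (of_int d / real N) = (2 * pi) * of_int k" by (simp only: mult.commute)
    then have "of_int d / real N = of_int k"
      by (simp only: mult_cancel_left) simp
    then have "real_of_int d = of_int (k * int N)" using N by (simp add: field_simps)
    then have "d = k * int N" by linarith
    with False assms show False
      by (metis abs_mult abs_of_nat dvd_imp_le_int dvd_triv_right linorder_not_less)
  qed
  have "(\<Sum>x<N. cis (2 * pi * (real x * of_int d / real N))) = (\<Sum>x<N. q ^ x)"
    by (simp add: q_def DeMoivre algebra_simps)
  also have "\<dots> = (q ^ N - 1) / (q - 1)"
    using \<open>q \<noteq> 1\<close> by (rule geometric_sum)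
  also have "q ^ N = 1"
    using N by (simp add: q_def DeMoivre)
  finally show ?thesis using False by simp
qed simp

lemma sum_if_const: "(\<Sum>x\<in>X. if c then f x else 0) = (if c then sum f X else 0)"
  by simp

text \<open>The right-hand side is inclusion--exclusion over the two pairings \<open>j = k, l = m\<close> and
  \<open>j = l, k = m\<close>.\<close>

lemma sum_two_pairings:
  fixes G :: "'k \<Rightarrow> 'k \<Rightarrow> 'k \<Rightarrow> 'k \<Rightarrow> complex"
  assumes "finite J"
  shows "(\<Sum>j\<in>J. \<Sum>k\<in>J. \<Sum>l\<in>J. \<Sum>m\<in>J. if j = k \<and> m = l \<or> j = l \<and> m = k then G j k l m else 0) =
    (\<Sum>j\<in>J. \<Sum>l\<in>J. G j j l l) + (\<Sum>j\<in>J. \<Sum>k\<in>J. G j k j k) - (\<Sum>j\<in>J. G j j j j)"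
proof -
  have "(if j = k \<and> m = l \<or> j = l \<and> m = k then G j k l m else 0) =
      (if j = k then if m = l then G j j l l else 0 else 0) + (if j = l then if m = k then G j k j k else 0 else 0)
      - (if j = k then if j = l then if m = j then G j j j j else 0 else 0 else 0)" for j k l m
    by auto
  then show ?thesis
    using assms by (simp add: sum.distrib sum_subtractf sum_if_const)
qed

lemma orthonormal_on_ket_tensor:
  assumes "orthonormal_on A J f" "orthonormal_on B J g"
  shows "orthonormal_on (A \<times> B) J (\<lambda>j. ket_tensor (f j) (g j))"
  using orthonormal_onD[OF assms(1)] orthonormal_onD[OF assms(2)]
  by (auto simp: orthonormal_on_def braket_ket_tensor) (auto simp: is_ket_def ket_tensor_def)

lemma sum_split_diagonal:
  fixes D :: "'k \<Rightarrow> 'k \<Rightarrow> 'c :: comm_monoid_add"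
  assumes "finite J"
  shows "(\<Sum>j\<in>J. \<Sum>l\<in>J. D j l) = (\<Sum>j\<in>J. D j j) + (\<Sum>(j, l)\<in>{(j, l) \<in> J \<times> J. j \<noteq> l}. D j l)"
proof -
  have "(\<Sum>j\<in>J. \<Sum>l\<in>J. D j l) = (\<Sum>(j, l)\<in>J \<times> J. D j l)"
    by (simp add: sum.cartesian_product)
  also have "\<dots> = (\<Sum>(j, l)\<in>(\<lambda>j. (j, j)) ` J \<union> {(j, l) \<in> J \<times> J. j \<noteq> l}. D j l)"
    by (rule sum.cong) auto
  also have "\<dots> = (\<Sum>(j, l)\<in>(\<lambda>j. (j, j)) ` J. D j l) + (\<Sum>(j, l)\<in>{(j, l) \<in> J \<times> J. j \<noteq> l}. D j l)"
  proof (rule sum.union_disjoint)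
    show "finite {(j, l) \<in> J \<times> J. j \<noteq> l}"
      by (rule finite_subset[of _ "J \<times> J"]) (use assms in auto)
  qed (use assms in auto)
  also have "(\<Sum>(j, l)\<in>(\<lambda>j. (j, j)) ` J. D j l) = (\<Sum>j\<in>J. D j j)"
    by (subst sum.reindex) (auto simp: inj_on_def)
  finally show ?thesis .
qed

section \<open>Extent and robustness of a Schmidt decomposition\<close>

text \<open>The index type is left open so that the \<open>n\<close>-copy state is again an
  instance, indexed by lists.\<close>

locale schmidt_decomposition =
  fixes A :: "'a set" and B :: "'b set" and J :: "'k set"
    and f :: "'k \<Rightarrow> 'a ket" and g :: "'k \<Rightarrow> 'b ket" and u :: "'k \<Rightarrow> real"
  assumes finite_A: "finite A" and finite_B: "finite B" and finite_J: "finite J"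
    and f: "orthonormal_on A J f" and g: "orthonormal_on B J g"
    and u_pos: "j \<in> J \<Longrightarrow> u j > 0"
    and u_norm: "(\<Sum>j\<in>J. (u j)\<^sup>2) = 1"
begin

definition psi :: "('a \<times> 'b) ket" where
  "psi = (\<lambda>x. \<Sum>j\<in>J. of_real (u j) * ket_tensor (f j) (g j) x)"

text \<open>The unnormalized maximally entangled vector in the Schmidt bases. The coefficient
  \<open>1\<close> is written out so that the rules for linear combinations match.\<close>

definition witness :: "('a \<times> 'b) ket" where
  "witness = (\<lambda>x. \<Sum>j\<in>J. 1 * ket_tensor (f j) (g j) x)"

definition S :: real where "S = (\<Sum>j\<in>J. u j)"

lemmas orthonormal_product = orthonormal_on_ket_tensor[OF f g]

lemma J_nonempty: "J \<noteq> {}"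
  using u_norm by auto

lemma S_pos: "S > 0"
  unfolding S_def using finite_J J_nonempty u_pos by (intro sum_pos) auto

text \<open>The diagonal terms add up to one by normalization; the off-diagonal sum is the trace of
  the noise that is mixed in later.\<close>

lemma S_squared: "S\<^sup>2 = 1 + (\<Sum>(j, l)\<in>{(j, l) \<in> J \<times> J. j \<noteq> l}. u j * u l)"
proof -
  have "S\<^sup>2 = (\<Sum>j\<in>J. \<Sum>l\<in>J. u j * u l)"
    by (simp add: S_def power2_eq_square sum_product)
  then show ?thesis
    unfolding sum_split_diagonal[OF finite_J] using u_norm by (simp add: power2_eq_square)
qed

lemma one_le_S_squared: "1 \<le> S\<^sup>2"
  unfolding S_squared using u_pos by (auto simp: less_imp_le intro!: sum_nonneg)

section \<open>Lower bounds from the witness vector\<close>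

lemma braket_witness_ket_tensor:
  "braket (A \<times> B) witness (ket_tensor v w) = (\<Sum>j\<in>J. braket A (f j) v * braket B (g j) w)"
  by (simp only: witness_def braket_sum_left braket_ket_tensor) simp

text \<open>The overlap is a sum of products of Fourier coefficients: Cauchy--Schwarz separates the
  two sides, and Bessel bounds each of them.\<close>

lemma cmod_witness_le:
  "(cmod (braket (A \<times> B) witness (ket_tensor v w)))\<^sup>2 \<le> Re (braket A v v) * Re (braket B w w)"
proof -
  have "(cmod (braket (A \<times> B) witness (ket_tensor v w)))\<^sup>2 \<le>
      (\<Sum>j\<in>J. (cmod (braket A (f j) v))\<^sup>2) * (\<Sum>j\<in>J. (cmod (braket B (g j) w))\<^sup>2)"
    unfolding braket_witness_ket_tensor by (rule sum_cmod_mult_squared_le)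
  also have "\<dots> \<le> Re (braket A v v) * Re (braket B w w)"
    by (intro mult_mono bessel[OF f finite_J] bessel[OF g finite_J] braket_self_nonneg sum_nonneg) auto
  finally show ?thesis .
qed

text \<open>Splitting both factors into rank-one terms makes the form a sum of squared overlaps with
  product vectors, and the bounds on these multiply out to the product of the two traces.\<close>

lemma witness_op_tensor:
  assumes "density_op A \<rho>" "density_op B \<sigma>"
  obtains t where "quad_form (A \<times> B) (op_tensor \<rho> \<sigma>) witness = of_real t" "0 \<le> t" "t \<le> 1"
proof -
  obtain m :: nat and v where
    v: "\<And>x y. x \<in> A \<Longrightarrow> y \<in> A \<Longrightarrow> \<rho> x y = (\<Sum>i<m. ketbra (v i) x y)" "(\<Sum>i<m. Re (braket A (v i) (v i))) = 1"
    using density_op_decomposition[OF finite_A assms(1)] by metis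
  obtain n :: nat and w where
    w: "\<And>x y. x \<in> B \<Longrightarrow> y \<in> B \<Longrightarrow> \<sigma> x y = (\<Sum>i<n. ketbra (w i) x y)" "(\<Sum>i<n. Re (braket B (w i) (w i))) = 1"
    using density_op_decomposition[OF finite_B assms(2)] by metis
  define s where "s i = (cmod (braket (A \<times> B) witness (ket_tensor (v (fst i)) (w (snd i)))))\<^sup>2" for i
  have "quad_form (A \<times> B) (op_tensor \<rho> \<sigma>) witness =
      quad_form (A \<times> B) (\<lambda>x y. \<Sum>i\<in>{..<m} \<times> {..<n}. 1 * ketbra (ket_tensor (v (fst i)) (w (snd i))) x y) witness"
    by (rule quad_form_cong)
      (auto simp: op_tensor_def v(1) w(1) sum_product sum.cartesian_product ketbra_def ket_tensor_def split_def ac_simps)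
  also have "\<dots> = of_real (\<Sum>i\<in>{..<m} \<times> {..<n}. s i)"
    by (simp only: quad_form_sum quad_form_ketbra s_def) simp
  finally have eq: "quad_form (A \<times> B) (op_tensor \<rho> \<sigma>) witness = of_real (\<Sum>i\<in>{..<m} \<times> {..<n}. s i)" .
  have "(\<Sum>i\<in>{..<m} \<times> {..<n}. s i) \<le>
      (\<Sum>i\<in>{..<m} \<times> {..<n}. Re (braket A (v (fst i)) (v (fst i))) * Re (braket B (w (snd i)) (w (snd i))))"
    unfolding s_def by (intro sum_mono cmod_witness_le)
  also have "\<dots> = (\<Sum>i<m. Re (braket A (v i) (v i))) * (\<Sum>i<n. Re (braket B (w i) (w i)))"
    by (simp add: sum_product sum.cartesian_product split_def)
  finally have "(\<Sum>i\<in>{..<m} \<times> {..<n}. s i) \<le> 1" by (simp add: v w)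
  moreover have "0 \<le> (\<Sum>i\<in>{..<m} \<times> {..<n}. s i)" by (simp add: s_def sum_nonneg)
  ultimately show ?thesis by (rule that[OF eq, rotated])
qed

lemma witness_SEP:
  assumes "\<tau> \<in> SEP A B"
  obtains t where "quad_form (A \<times> B) \<tau> witness = of_real t" "0 \<le> t" "t \<le> 1"
proof -
  obtain m :: nat and p \<rho> \<sigma> where *:
    "\<forall>i\<in>{1..m}. 0 \<le> p i \<and> density_op A (\<rho> i) \<and> density_op B (\<sigma> i)" "(\<Sum>i=1..m. p i) = 1"
    "\<tau> = (\<lambda>x y. \<Sum>i=1..m. of_real (p i) * op_tensor (\<rho> i) (\<sigma> i) x y)"
    using assms unfolding SEP_def by blast
  have "\<forall>i\<in>{1..m}. \<exists>t. quad_form (A \<times> B) (op_tensor (\<rho> i) (\<sigma> i)) witness = of_real t \<and> 0 \<le> t \<and> t \<le> 1"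
    using *(1) by (blast elim: witness_op_tensor)
  then obtain t where t: "\<And>i. i \<in> {1..m} \<Longrightarrow> quad_form (A \<times> B) (op_tensor (\<rho> i) (\<sigma> i)) witness = of_real (t i)"
    "\<And>i. i \<in> {1..m} \<Longrightarrow> 0 \<le> t i" "\<And>i. i \<in> {1..m} \<Longrightarrow> t i \<le> 1"
    by metis
  have "quad_form (A \<times> B) \<tau> witness = of_real (\<Sum>i=1..m. p i * t i)"
    using t(1) by (simp add: *(3) quad_form_sum)
  moreover have "(\<Sum>i=1..m. p i * t i) \<le> (\<Sum>i=1..m. p i)"
    using t *(1) by (intro sum_mono mult_left_le) auto
  moreover have "0 \<le> (\<Sum>i=1..m. p i * t i)"
    using t *(1) by (intro sum_nonneg) auto
  ultimately show ?thesis using *(2) by (intro that) simp_all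
qed

lemma is_ket_psi: "is_ket (A \<times> B) psi"
  unfolding psi_def by (intro is_ket_sum orthonormal_onD(1)[OF orthonormal_product])

lemma braket_psi: "braket (A \<times> B) psi psi = 1"
proof -
  have "braket (A \<times> B) psi psi = of_real (\<Sum>j\<in>J. (u j)\<^sup>2)"
    unfolding psi_def braket_orthonormal_sum[OF orthonormal_product finite_J]
    by (simp add: power2_eq_square)
  then show ?thesis by (simp add: u_norm)
qed

lemma op_trace_psi: "op_trace (A \<times> B) (ketbra psi) = 1"
  using density_op_ketbra[OF is_ket_psi braket_psi] by (simp add: density_op_def)

lemma witness_psi: "quad_form (A \<times> B) (ketbra psi) witness = of_real (S\<^sup>2)"
proof -
  have "braket (A \<times> B) witness psi = of_real S"
    unfolding psi_def witness_def braket_orthonormal_sum[OF orthonormal_product finite_J]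
    by (simp add: S_def)
  then show ?thesis by (simp add: quad_form_ketbra)
qed

text \<open>The trace gives the first claim and the witness the second: a term contributes at most
  its coefficient if that is positive, and at most zero otherwise. The finite index set is arbitrary
  so that the bound serves both the extent and the robustness.\<close>

lemma quasiprobability_lower_bound:
  assumes "finite X" "\<And>i. i \<in> X \<Longrightarrow> \<tau> i \<in> SEP A B"
    and eq: "ketbra psi = (\<lambda>x y. \<Sum>i\<in>X. of_real (a i) * \<tau> i x y)"
  shows "(\<Sum>i\<in>X. a i) = 1" and "S\<^sup>2 \<le> (\<Sum>i\<in>X. max 0 (a i))"
proof -
  have "of_real (\<Sum>i\<in>X. a i) = op_trace (A \<times> B) (ketbra psi)"
    unfolding eq op_trace_sum by (simp add: op_trace_SEP assms(2))
  then show "(\<Sum>i\<in>X. a i) = 1"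
    unfolding op_trace_psi by (simp flip: of_real_sum)
  have "\<forall>i\<in>X. \<exists>t. quad_form (A \<times> B) (\<tau> i) witness = of_real t \<and> 0 \<le> t \<and> t \<le> 1"
    using assms(2) by (blast elim: witness_SEP)
  then obtain t where t: "\<And>i. i \<in> X \<Longrightarrow> quad_form (A \<times> B) (\<tau> i) witness = of_real (t i)"
    "\<And>i. i \<in> X \<Longrightarrow> 0 \<le> t i" "\<And>i. i \<in> X \<Longrightarrow> t i \<le> 1"
    by metis
  have "of_real (S\<^sup>2) = (of_real (\<Sum>i\<in>X. a i * t i) :: complex)"
    unfolding witness_psi[symmetric] unfolding eq quad_form_sum using t(1) by simp
  then have "S\<^sup>2 = (\<Sum>i\<in>X. a i * t i)"
    using of_real_eq_iff by blast
  also have "\<dots> \<le> (\<Sum>i\<in>X. max 0 (a i))"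
  proof (rule sum_mono)
    fix i assume "i \<in> X"
    then show "a i * t i \<le> max 0 (a i)"
      using t(2,3)[of i] by (cases "a i \<ge> 0") (auto simp: mult_left_le mult_nonpos_nonneg)
  qed
  finally show "S\<^sup>2 \<le> (\<Sum>i\<in>X. max 0 (a i))" .
qed

end

section \<open>Upper bounds by averaging product states over phases\<close>

context schmidt_decomposition
begin

text \<open>The phases \<open>cis (2 \<pi> x 2\<^sup>h / N)\<close> are characters of \<open>\<int>/N\<close> at powers of two, a Sidon set, so
  averaging over \<open>x\<close> kills every term of \<open>z\<^sub>j z\<^sub>m / (z\<^sub>k z\<^sub>l)\<close> except those with
  \<open>{j, m} = {k, l}\<close>.\<close>

lemma phases:
  obtains N :: nat and z :: "nat \<Rightarrow> 'k \<Rightarrow> complex"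
  where "N > 0" "\<And>x j. cmod (z x j) = 1"
    "\<And>j k l m. j \<in> J \<Longrightarrow> k \<in> J \<Longrightarrow> l \<in> J \<Longrightarrow> m \<in> J \<Longrightarrow>
      (\<Sum>x<N. z x j * cnj (z x k) * cnj (z x l) * z x m) =
      (if j = k \<and> m = l \<or> j = l \<and> m = k then of_nat N else 0)"
proof -
  obtain h where h: "bij_betw h J {0..<card J}"
    using ex_bij_betw_finite_nat[OF finite_J] by blast
  \<comment> \<open>Each power \<open>2 ^ h j\<close> is below \<open>N / 2\<close>, so two sums of
    two such powers differ by less than \<open>N\<close> and are congruent only if equal.\<close>
  define N :: nat where "N = 2 ^ Suc (card J)"
  define z where "z x j = cis (2 * pi * (real x * 2 ^ h j / real N))" for x :: nat and j
  have "(\<Sum>x<N. z x j * cnj (z x k) * cnj (z x l) * z x m) =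
      (if j = k \<and> m = l \<or> j = l \<and> m = k then of_nat N else 0)"
    if "j \<in> J" "k \<in> J" "l \<in> J" "m \<in> J" for j k l m
  proof -
    define d :: int where "d = 2 ^ h j + 2 ^ h m - (2 ^ h k + 2 ^ h l)"
    have "(2::int) ^ h i < 2 ^ card J" if "i \<in> J" for i
      using bij_betwE[OF h] that by (intro power_strict_increasing) auto
    note upper = this[OF that(1)] this[OF that(2)] this[OF that(3)] this[OF that(4)]
    have lower: "0 < (2::int) ^ h i" for i by simp
    have "int N = 2 * 2 ^ card J" by (simp add: N_def)
    then have "\<bar>d\<bar> < int N"
      unfolding d_def using upper lower[of j] lower[of k] lower[of l] lower[of m] by linarith
    have "d = 0 \<longleftrightarrow> int (2 ^ h j + 2 ^ h m) = int (2 ^ h k + 2 ^ h l)"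
      by (simp add: d_def)
    also have "\<dots> \<longleftrightarrow> (2::nat) ^ h j + 2 ^ h m = 2 ^ h k + 2 ^ h l"
      by (rule of_nat_eq_iff)
    also have "\<dots> \<longleftrightarrow> h j = h k \<and> h m = h l \<or> h j = h l \<and> h m = h k"
      using two_powers_sum_eq by auto
    also have "\<dots> \<longleftrightarrow> j = k \<and> m = l \<or> j = l \<and> m = k"
      using bij_betw_imp_inj_on[OF h] that by (simp add: inj_on_eq_iff)
    finally have d0: "d = 0 \<longleftrightarrow> j = k \<and> m = l \<or> j = l \<and> m = k" .
    have "z x j * cnj (z x k) * cnj (z x l) * z x m = cis (2 * pi * (real x * of_int d / real N))" for x
      by (simp add: z_def cis_cnj cis_mult d_def diff_divide_distrib add_divide_distrib algebra_simps)
    then show ?thesis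
      using sum_cis_character[OF \<open>\<bar>d\<bar> < int N\<close>] d0 by simp
  qed
  then show ?thesis
    by (intro that[of N z]) (auto simp: N_def z_def)
qed

text \<open>The two factors carry opposite phases. Of the surviving index pairings,
  \<open>j = l, m = k\<close> rebuilds the entangled state and \<open>j = k, m = l\<close> gives a
  diagonal operator; their common part is counted once.\<close>

lemma separable_twirl:
  obtains \<tau> where "\<tau> \<in> SEP A B"
    "\<And>x y. of_real (S\<^sup>2) * \<tau> x y = ketbra psi x y +
      (\<Sum>(j, l)\<in>{(j, l) \<in> J \<times> J. j \<noteq> l}. of_real (u j * u l) * op_tensor (ketbra (f j)) (ketbra (g l)) x y)"
proof -
  obtain N :: nat and z where N: "N > 0" and z: "\<And>x j. cmod (z x j) = 1"
    and zz: "\<And>j k l m. j \<in> J \<Longrightarrow> k \<in> J \<Longrightarrow> l \<in> J \<Longrightarrow> m \<in> J \<Longrightarrow>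
      (\<Sum>x<N. z x j * cnj (z x k) * cnj (z x l) * z x m) =
      (if j = k \<and> m = l \<or> j = l \<and> m = k then of_nat N else 0)"
    using phases by blast
  \<comment> \<open>The squares of these amplitudes sum to one, and each amplitude occurs twice in a
    surviving term, so multiplying by \<open>S\<^sup>2\<close> leaves
    \<open>u j * u l\<close>.\<close>
  define c :: "'k \<Rightarrow> complex" where "c j = of_real (sqrt (u j / S))" for j
  have cc: "c j * c j = of_real (u j / S)" if "j \<in> J" for j
    using u_pos[OF that] S_pos by (simp add: c_def flip: of_real_mult)
  have cnj_c: "cnj (c j) = c j" for j by (simp add: c_def)
  have zz1: "cnj (z x j) * z x j = 1" for x j
    by (simp add: mult.commute[of "cnj _"] mult_cnj_cmod z)
  define v where "v x = (\<lambda>a. \<Sum>j\<in>J. (c j * z x j) * f j a)" for x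
  define w where "w x = (\<lambda>b. \<Sum>j\<in>J. (c j * cnj (z x j)) * g j b)" for x
  have norm1: "(\<Sum>j\<in>J. c j * c j) = 1"
  proof -
    have "(\<Sum>j\<in>J. c j * c j) = of_real (\<Sum>j\<in>J. u j / S)" by (simp add: cc)
    also have "(\<Sum>j\<in>J. u j / S) = 1"
      using S_pos by (simp add: sum_divide_distrib[symmetric] S_def)
    finally show ?thesis by simp
  qed
  have "braket A (v x) (v x) = (\<Sum>j\<in>J. c j * c j * (cnj (z x j) * z x j))" for x
    unfolding v_def braket_orthonormal_sum[OF f finite_J] by (simp add: cnj_c ac_simps)
  then have v: "density_op A (ketbra (v x))" for x
    unfolding v_def by (intro density_op_ketbra is_ket_sum orthonormal_onD(1)[OF f]) (simp_all add: zz1 norm1)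
  have "braket B (w x) (w x) = (\<Sum>j\<in>J. c j * c j * (cnj (z x j) * z x j))" for x
    unfolding w_def braket_orthonormal_sum[OF g finite_J] by (simp add: cnj_c ac_simps)
  then have w: "density_op B (ketbra (w x))" for x
    unfolding w_def by (intro density_op_ketbra is_ket_sum orthonormal_onD(1)[OF g]) (simp_all add: zz1 norm1)
  define \<tau> where "\<tau> = (\<lambda>x y. \<Sum>i<N. of_real (1 / real N) * op_tensor (ketbra (v i)) (ketbra (w i)) x y)"
  have "\<tau> \<in> SEP A B"
    unfolding \<tau>_def using N v w by (intro SEP_convex_combination) auto
  moreover have "of_real (S\<^sup>2) * \<tau> x y = ketbra psi x y +
      (\<Sum>(j, l)\<in>{(j, l) \<in> J \<times> J. j \<noteq> l}. of_real (u j * u l) * op_tensor (ketbra (f j)) (ketbra (g l)) x y)" for x y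
  proof -
    obtain a b a' b' where xy: "x = (a, b)" "y = (a', b')" by (cases x, cases y) auto
    define F where "F j k l m = f j a * cnj (f k a') * g l b * cnj (g m b')" for j k l m
    define C where "C j k l m = c j * c k * c l * c m * F j k l m" for j k l m
    have "op_tensor (ketbra (v i)) (ketbra (w i)) x y =
        (\<Sum>j\<in>J. \<Sum>k\<in>J. \<Sum>l\<in>J. \<Sum>m\<in>J. C j k l m * (z i j * cnj (z i k) * cnj (z i l) * z i m))" for i
    proof -
      have "op_tensor (ketbra (v i)) (ketbra (w i)) x y =
          (\<Sum>j\<in>J. \<Sum>k\<in>J. (c j * z i j * f j a) * cnj (c k * z i k * f k a')) *
          (\<Sum>l\<in>J. \<Sum>m\<in>J. (c l * cnj (z i l) * g l b) * cnj (c m * cnj (z i m) * g m b'))"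
        by (simp only: xy op_tensor_def ketbra_def split_conv v_def w_def cnj_sum sum_product)
      also have "\<dots> = (\<Sum>j\<in>J. \<Sum>k\<in>J. \<Sum>l\<in>J. \<Sum>m\<in>J. C j k l m * (z i j * cnj (z i k) * cnj (z i l) * z i m))"
        unfolding sum_distrib_right unfolding sum_distrib_left
        by (intro sum.cong refl) (simp add: C_def F_def cnj_c)
      finally show ?thesis .
    qed
    then have "\<tau> x y = (\<Sum>i<N. of_real (1 / real N) * (\<Sum>j\<in>J. \<Sum>k\<in>J. \<Sum>l\<in>J. \<Sum>m\<in>J.
        C j k l m * (z i j * cnj (z i k) * cnj (z i l) * z i m)))"
      by (simp only: \<tau>_def)
    \<comment> \<open>The average moves innermost, where only the phases depend on
      \<open>i\<close>.\<close>
    also have "\<dots> = of_real (1 / real N) * (\<Sum>j\<in>J. \<Sum>k\<in>J. \<Sum>l\<in>J. \<Sum>m\<in>J.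
        C j k l m * (\<Sum>i<N. z i j * cnj (z i k) * cnj (z i l) * z i m))"
      by (simp only: sum_distrib_left[symmetric] sum.swap[of _ J "{..<N}"])
    also have "\<dots> = of_real (1 / real N) * (\<Sum>j\<in>J. \<Sum>k\<in>J. \<Sum>l\<in>J. \<Sum>m\<in>J.
        of_nat N * (if j = k \<and> m = l \<or> j = l \<and> m = k then C j k l m else 0))"
      by (rule arg_cong[where f = "(*) _"], intro sum.cong refl) (simp add: zz)
    also have "\<dots> = (\<Sum>j\<in>J. \<Sum>k\<in>J. \<Sum>l\<in>J. \<Sum>m\<in>J.
        if j = k \<and> m = l \<or> j = l \<and> m = k then C j k l m else 0)"
      using N by (simp only: sum_distrib_left[symmetric]) simp
    also have "\<dots> = (\<Sum>j\<in>J. \<Sum>l\<in>J. C j j l l) + (\<Sum>j\<in>J. \<Sum>k\<in>J. C j k j k) - (\<Sum>j\<in>J. C j j j j)"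
      by (rule sum_two_pairings[OF finite_J])
    finally have \<tau>: "\<tau> x y = (\<Sum>j\<in>J. \<Sum>l\<in>J. C j j l l) + (\<Sum>j\<in>J. \<Sum>k\<in>J. C j k j k) - (\<Sum>j\<in>J. C j j j j)" .
    have SC: "of_real (S\<^sup>2) * C j j l l = of_real (u j * u l) * F j j l l"
      "of_real (S\<^sup>2) * C j l j l = of_real (u j * u l) * F j l j l" if "j \<in> J" "l \<in> J" for j l
    proof -
      have "of_real (S\<^sup>2) * ((c j * c j) * (c l * c l)) = (of_real (u j * u l) :: complex)"
        using S_pos that by (simp add: cc power2_eq_square)
      moreover have "C j j l l = ((c j * c j) * (c l * c l)) * F j j l l"
        "C j l j l = ((c j * c j) * (c l * c l)) * F j l j l"
        by (simp_all only: C_def ac_simps)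
      ultimately show "of_real (S\<^sup>2) * C j j l l = of_real (u j * u l) * F j j l l"
        "of_real (S\<^sup>2) * C j l j l = of_real (u j * u l) * F j l j l"
        by (metis mult.assoc)+
    qed
    define D where "D j l = of_real (u j * u l) * F j j l l" for j l
    note D = sum_split_diagonal[OF finite_J, of D]
    have psi: "ketbra psi x y = (\<Sum>j\<in>J. \<Sum>k\<in>J. of_real (u j * u k) * F j k j k)"
      by (simp add: ketbra_def psi_def xy ket_tensor_def F_def sum_product ac_simps)
    have "of_real (S\<^sup>2) * \<tau> x y = (\<Sum>j\<in>J. \<Sum>l\<in>J. D j l)
        + (\<Sum>j\<in>J. \<Sum>k\<in>J. of_real (u j * u k) * F j k j k) - (\<Sum>j\<in>J. D j j)"
      unfolding \<tau> right_diff_distrib distrib_left sum_distrib_left D_def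
      by (intro arg_cong2[where f = "(+)"] arg_cong2[where f = "(-)"] sum.cong refl SC) auto
    \<comment> \<open>The diagonal of \<open>D\<close> cancels against the subtracted overlap of the
      two pairings.\<close>
    also have "\<dots> = ketbra psi x y + (\<Sum>(j, l)\<in>{(j, l) \<in> J \<times> J. j \<noteq> l}. D j l)"
      unfolding D psi by simp
    also have "(\<Sum>(j, l)\<in>{(j, l) \<in> J \<times> J. j \<noteq> l}. D j l) =
        (\<Sum>(j, l)\<in>{(j, l) \<in> J \<times> J. j \<noteq> l}. of_real (u j * u l) * op_tensor (ketbra (f j)) (ketbra (g l)) x y)"
      by (intro sum.cong refl) (auto simp: D_def F_def xy op_tensor_def ketbra_def)
    finally show ?thesis .
  qed
  ultimately show ?thesis by (rule that)
qed

text \<open>The noise term of the twirl is a positive combination of product states; dividing by its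
  trace \<open>S\<^sup>2 - 1\<close> makes it a separable state. The resulting identity supplies the
  optimal choice for both the extent and the robustness.\<close>

lemma separable_mixing:
  obtains \<sigma> \<tau> where "\<sigma> \<in> SEP A B" "\<tau> \<in> SEP A B"
    "\<And>x y. ketbra psi x y + of_real (S\<^sup>2 - 1) * \<sigma> x y = of_real (S\<^sup>2) * \<tau> x y"
proof -
  define X where "X = {(j, l) \<in> J \<times> J. j \<noteq> l}"
  have fin: "finite X" unfolding X_def by (rule finite_subset[of _ "J \<times> J"]) (use finite_J in auto)
  have S2: "(\<Sum>i\<in>X. u (fst i) * u (snd i)) = S\<^sup>2 - 1"
    by (simp add: S_squared X_def split_def)
  have pos: "0 < u (fst i) * u (snd i)" if "i \<in> X" for i
    using that u_pos by (auto simp: X_def)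
  define T where "T i = op_tensor (ketbra (f (fst i))) (ketbra (g (snd i)))" for i :: "'k \<times> 'k"
  obtain \<tau> where \<tau>_SEP: "\<tau> \<in> SEP A B" and "\<And>x y. of_real (S\<^sup>2) * \<tau> x y = ketbra psi x y +
      (\<Sum>(j, l)\<in>{(j, l) \<in> J \<times> J. j \<noteq> l}. of_real (u j * u l) * op_tensor (ketbra (f j)) (ketbra (g l)) x y)"
    by (rule separable_twirl) (rule that)
  then have \<tau>: "of_real (S\<^sup>2) * \<tau> x y = ketbra psi x y + (\<Sum>i\<in>X. of_real (u (fst i) * u (snd i)) * T i x y)" for x y
    by (simp add: X_def T_def split_def)
  show ?thesis
  proof (cases "S\<^sup>2 = 1")
    \<comment> \<open>There is no noise to normalize here; \<open>\<tau>\<close> itself can stand in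
      for \<open>\<sigma>\<close>, whose coefficient is zero.\<close>
    case True
    then have "X = {}"
      using S2 sum_pos[OF fin _ pos] by fastforce
    with \<tau>_SEP \<tau> True show ?thesis by (intro that[of \<tau> \<tau>]) auto
  next
    case False
    with one_le_S_squared have t: "S\<^sup>2 - 1 > 0" by simp
    define \<sigma> where "\<sigma> = (\<lambda>x y. \<Sum>i\<in>X. of_real (u (fst i) * u (snd i) / (S\<^sup>2 - 1)) * T i x y)"
    have "\<sigma> \<in> SEP A B"
      unfolding \<sigma>_def T_def
    proof (rule SEP_convex_combination[OF fin])
      show "(\<Sum>i\<in>X. u (fst i) * u (snd i) / (S\<^sup>2 - 1)) = 1"
        using t S2 by (simp add: sum_divide_distrib[symmetric])
      fix i assume i: "i \<in> X"
      then have J: "fst i \<in> J" "snd i \<in> J" by (auto simp: X_def)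
      show "0 \<le> u (fst i) * u (snd i) / (S\<^sup>2 - 1)"
        using pos[OF i] t by (intro divide_nonneg_pos) auto
      show "density_op A (ketbra (f (fst i)))" "density_op B (ketbra (g (snd i)))"
        using J orthonormal_onD[OF f] orthonormal_onD[OF g] by (auto intro!: density_op_ketbra)
    qed
    moreover have "of_real (S\<^sup>2 - 1) * \<sigma> x y = (\<Sum>i\<in>X. of_real (u (fst i) * u (snd i)) * T i x y)" for x y
    proof -
      have "of_real (S\<^sup>2 - 1) * (of_real (u (fst i) * u (snd i) / (S\<^sup>2 - 1)) * T i x y) =
          of_real (u (fst i) * u (snd i)) * T i x y" for i
        using t by (simp only: mult.assoc[symmetric] of_real_mult[symmetric]) simp
      then show ?thesis unfolding \<sigma>_def sum_distrib_left by simp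
    qed
    ultimately show ?thesis using \<tau>_SEP \<tau> by (intro that[of \<sigma> \<tau>]) auto
  qed
qed

text \<open>The infimum is attained by the two-term decomposition with weights
  \<open>S\<^sup>2\<close> and \<open>- (S\<^sup>2 - 1)\<close> read off from
  \<open>separable_mixing\<close>.\<close>

lemma qp_extent_psi: "qp_extent A B (ketbra psi) = 2 * S\<^sup>2 - 1"
  unfolding qp_extent_def
proof (rule cInf_eq_minimum)
  obtain \<sigma> \<tau> where *: "\<sigma> \<in> SEP A B" "\<tau> \<in> SEP A B"
    "\<And>x y. ketbra psi x y + of_real (S\<^sup>2 - 1) * \<sigma> x y = of_real (S\<^sup>2) * \<tau> x y"
    by (rule separable_mixing) (rule that)
  have "ketbra psi x y = of_real (S\<^sup>2) * \<tau> x y - of_real (S\<^sup>2 - 1) * \<sigma> x y" for x y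
    using *(3)[of x y] by (simp add: eq_diff_eq)
  then have "ketbra psi = (\<lambda>x y. \<Sum>i=1..2::nat. of_real (if i = 1 then S\<^sup>2 else - (S\<^sup>2 - 1)) * (if i = 1 then \<tau> else \<sigma>) x y)"
    by (intro ext) (simp add: numeral_2_eq_2 algebra_simps)
  moreover have "2 * S\<^sup>2 - 1 = (\<Sum>i=1..2::nat. \<bar>if i = 1 then S\<^sup>2 else - (S\<^sup>2 - 1)\<bar>)"
    using one_le_S_squared by (simp add: numeral_2_eq_2)
  ultimately show "2 * S\<^sup>2 - 1 \<in> {s. \<exists>(m::nat) a \<tau>. m \<ge> 1 \<and> (\<forall>i\<in>{1..m}. \<tau> i \<in> SEP A B) \<and>
      ketbra psi = (\<lambda>x y. \<Sum>i=1..m. of_real (a i) * \<tau> i x y) \<and> s = (\<Sum>i=1..m. \<bar>a i\<bar>)}"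
    using *(1,2)
    by (intro CollectI exI[of _ 2] exI[of _ "\<lambda>i. if i = 1 then S\<^sup>2 else - (S\<^sup>2 - 1)"]
        exI[of _ "\<lambda>i. if i = 1 then \<tau> else \<sigma>"] conjI) simp_all
next
  fix s assume "s \<in> {s. \<exists>(m::nat) a \<tau>. m \<ge> 1 \<and> (\<forall>i\<in>{1..m}. \<tau> i \<in> SEP A B) \<and>
      ketbra psi = (\<lambda>x y. \<Sum>i=1..m. of_real (a i) * \<tau> i x y) \<and> s = (\<Sum>i=1..m. \<bar>a i\<bar>)}"
  then obtain m :: nat and a \<tau> where *: "\<And>i. i \<in> {1..m} \<Longrightarrow> \<tau> i \<in> SEP A B"
    "ketbra psi = (\<lambda>x y. \<Sum>i=1..m. of_real (a i) * \<tau> i x y)" "s = (\<Sum>i=1..m. \<bar>a i\<bar>)"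
    by blast
  \<comment> \<open>This form of the absolute value reduces the bound to the positive weights and
    the total weight, which is one.\<close>
  have "s = (\<Sum>i=1..m. 2 * max 0 (a i) - a i)"
    unfolding *(3) by (intro sum.cong) auto
  also have "\<dots> = 2 * (\<Sum>i=1..m. max 0 (a i)) - (\<Sum>i=1..m. a i)"
    by (simp add: sum_subtractf sum_distrib_left)
  also have "\<dots> \<ge> 2 * S\<^sup>2 - 1"
    using quasiprobability_lower_bound[OF _ *(1,2)] by simp
  finally show "2 * S\<^sup>2 - 1 \<le> s" .
qed

lemma robustness_feasible_psi: "robustness_feasible A B (ketbra psi) (S\<^sup>2 - 1)"
proof -
  obtain \<sigma> \<tau> where *: "\<sigma> \<in> SEP A B" "\<tau> \<in> SEP A B"
    "\<And>x y. ketbra psi x y + of_real (S\<^sup>2 - 1) * \<sigma> x y = of_real (S\<^sup>2) * \<tau> x y"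
    by (rule separable_mixing) (rule that)
  have "(ketbra psi x y + of_real (S\<^sup>2 - 1) * \<sigma> x y) / of_real (1 + (S\<^sup>2 - 1)) = \<tau> x y" for x y
    unfolding *(3) using S_pos by simp
  then show ?thesis
    unfolding robustness_feasible_def using * one_le_S_squared
    by (intro conjI bexI[of _ \<sigma>]) (simp_all only: diff_ge_0_iff_ge)
qed

text \<open>A feasible mixture, solved for the pure state, is a quasiprobability decomposition with
  weights \<open>1 + t\<close> and \<open>- t\<close>, so its positive weight \<open>1 + t\<close>
  is at least \<open>S\<^sup>2\<close>.\<close>

lemma robustness_feasible_psi_le:
  assumes "robustness_feasible A B (ketbra psi) t"
  shows "S\<^sup>2 - 1 \<le> t"
proof -
  obtain \<sigma> \<tau> where *: "\<sigma> \<in> SEP A B" "\<tau> \<in> SEP A B" "0 \<le> t"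
    and \<tau>: "\<tau> = (\<lambda>x y. (ketbra psi x y + of_real t * \<sigma> x y) / of_real (1 + t))"
    using assms unfolding robustness_feasible_def by blast
  have "complex_of_real (1 + t) \<noteq> 0" using *(3) unfolding of_real_eq_0_iff by linarith
  then have "of_real (1 + t) * \<tau> x y = ketbra psi x y + of_real t * \<sigma> x y" for x y
    by (simp add: \<tau> del: of_real_add)
  then have "ketbra psi x y = of_real (1 + t) * \<tau> x y - of_real t * \<sigma> x y" for x y
    by simp
  then have "ketbra psi = (\<lambda>x y. \<Sum>i\<in>{True, False}. of_real (if i then 1 + t else - t) * (if i then \<tau> else \<sigma>) x y)"
    by (intro ext) simp
  moreover have "(if i then \<tau> else \<sigma>) \<in> SEP A B" for i
    using * by simp
  ultimately show ?thesis
    using quasiprobability_lower_bound(2)[of "{True, False}" "\<lambda>i. if i then \<tau> else \<sigma>" "\<lambda>i. if i then 1 + t else - t"] *(3)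
    by simp
qed

lemma robustness_psi: "robustness A B (ketbra psi) = S\<^sup>2 - 1"
  unfolding robustness_def
  by (rule Least_equality) (use robustness_feasible_psi robustness_feasible_psi_le in auto)

end

section \<open>Tensor powers\<close>

text \<open>The factors may differ from position to position; lists of another length get
  \<open>0\<close>, so that the vector vanishes off the power system.\<close>

definition power_ket :: "nat \<Rightarrow> (nat \<Rightarrow> 'i ket) \<Rightarrow> 'i list ket" where
  "power_ket n v xs = (if length xs = n then \<Prod>i<n. v i (xs ! i) else 0)"

lemma finite_power_system: "finite I \<Longrightarrow> finite (power_system n I)"
  using finite_lists_length_eq[of I n] by (simp add: power_system_def conj_commute)

lemma power_system_Suc: "power_system (Suc n) I = (\<lambda>(x, xs). x # xs) ` (I \<times> power_system n I)"
  by (auto simp: power_system_def length_Suc_conv image_iff)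

text \<open>General distributivity, with lists as the choice functions. Letting \<open>h\<close>
  depend on the position allows the shift in the induction.\<close>

lemma sum_power_system:
  fixes h :: "nat \<Rightarrow> 'i \<Rightarrow> 'c :: comm_semiring_1"
  shows "(\<Sum>xs\<in>power_system n I. \<Prod>i<n. h i (xs ! i)) = (\<Prod>i<n. \<Sum>x\<in>I. h i x)"
proof (induction n arbitrary: h)
  case 0
  have "power_system 0 I = {[]}" by (auto simp: power_system_def)
  then show ?case by simp
next
  case (Suc n)
  have "(\<Sum>xs\<in>power_system (Suc n) I. \<Prod>i<Suc n. h i (xs ! i)) =
      (\<Sum>(x, xs)\<in>I \<times> power_system n I. h 0 x * (\<Prod>i<n. h (Suc i) (xs ! i)))"
    unfolding power_system_Suc
    by (subst sum.reindex) (auto simp: inj_on_def split_def prod.lessThan_Suc_shift simp del: prod.lessThan_Suc)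
  also have "\<dots> = (\<Sum>x\<in>I. h 0 x) * (\<Sum>xs\<in>power_system n I. \<Prod>i<n. h (Suc i) (xs ! i))"
    by (simp add: sum_product sum.cartesian_product)
  also have "\<dots> = (\<Prod>i<Suc n. \<Sum>x\<in>I. h i x)"
    by (simp add: Suc.IH[of "\<lambda>i. h (Suc i)"] prod.lessThan_Suc_shift del: prod.lessThan_Suc)
  finally show ?case .
qed

lemma is_ket_power_ket:
  assumes "\<And>i. i < n \<Longrightarrow> is_ket I (v i)"
  shows "is_ket (power_system n I) (power_ket n v)"
  unfolding is_ket_def
proof (intro allI impI)
  fix xs assume xs: "xs \<notin> power_system n I"
  show "power_ket n v xs = 0"
  proof (cases "length xs = n")
    case True
    with xs obtain i where "i < n" "xs ! i \<notin> I"
      by (auto simp: power_system_def subset_iff in_set_conv_nth)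
    with assms show ?thesis
      by (auto simp: power_ket_def is_ket_def intro!: prod_zero)
  qed (simp add: power_ket_def)
qed

lemma braket_power_ket:
  "braket (power_system n I) (power_ket n v) (power_ket n w) = (\<Prod>i<n. braket I (v i) (w i))"
proof -
  have "braket (power_system n I) (power_ket n v) (power_ket n w) =
      (\<Sum>xs\<in>power_system n I. \<Prod>i<n. cnj (v i (xs ! i)) * w i (xs ! i))"
    unfolding braket_def by (intro sum.cong refl) (auto simp: power_ket_def power_system_def prod.distrib)
  also have "\<dots> = (\<Prod>i<n. braket I (v i) (w i))"
    unfolding braket_def by (rule sum_power_system)
  finally show ?thesis .
qed

text \<open>Brakets of product vectors factor, and a product of Kronecker deltas over all positions
  is the delta of the two lists.\<close>

lemma orthonormal_on_power_ket:
  assumes "orthonormal_on I K f"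
  shows "orthonormal_on (power_system n I) (power_system n K) (\<lambda>ks. power_ket n (\<lambda>i. f (ks ! i)))"
proof -
  have K: "ks ! i \<in> K" if "ks \<in> power_system n K" "i < n" for ks i
    using that by (auto simp: power_system_def)
  have "braket (power_system n I) (power_ket n (\<lambda>i. f (js ! i))) (power_ket n (\<lambda>i. f (ks ! i))) =
      (if js = ks then 1 else 0)" if "js \<in> power_system n K" "ks \<in> power_system n K" for js ks
  proof -
    have "braket (power_system n I) (power_ket n (\<lambda>i. f (js ! i))) (power_ket n (\<lambda>i. f (ks ! i))) =
        (\<Prod>i<n. if js ! i = ks ! i then 1 else 0)"
      unfolding braket_power_ket
      using orthonormal_onD(2)[OF assms] K that by (intro prod.cong refl) auto
    also have "\<dots> = (if js = ks then 1 else 0)"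
    proof (cases "js = ks")
      case False
      moreover have "length js = n" "length ks = n"
        using that by (auto simp: power_system_def)
      ultimately obtain i where "i < n" "js ! i \<noteq> ks ! i"
        by (auto simp: list_eq_iff_nth_eq)
      with False show ?thesis by (auto intro!: prod_zero)
    qed simp
    finally show ?thesis .
  qed
  moreover have "is_ket (power_system n I) (power_ket n (\<lambda>i. f (ks ! i)))" if "ks \<in> power_system n K" for ks
    using orthonormal_onD(1)[OF assms] K that by (intro is_ket_power_ket) auto
  ultimately show ?thesis by (simp add: orthonormal_on_def)
qed

lemma schmidt_decomposition_power:
  assumes "schmidt_decomposition A B J f g u"
  shows "schmidt_decomposition (power_system n A) (power_system n B) (power_system n J)
    (\<lambda>js. power_ket n (\<lambda>i. f (js ! i))) (\<lambda>js. power_ket n (\<lambda>i. g (js ! i))) (\<lambda>js. \<Prod>i<n. u (js ! i))"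
proof -
  interpret schmidt_decomposition A B J f g u by fact
  show ?thesis
  proof
    show "0 < (\<Prod>i<n. u (js ! i))" if "js \<in> power_system n J" for js
      using that by (intro prod_pos u_pos) (auto simp: power_system_def)
    have "(\<Sum>js\<in>power_system n J. (\<Prod>i<n. u (js ! i))\<^sup>2) =
        (\<Sum>js\<in>power_system n J. \<Prod>i<n. (u (js ! i))\<^sup>2)"
      by (simp add: prod_power_distrib)
    also have "\<dots> = (\<Prod>i<n. \<Sum>j\<in>J. (u j)\<^sup>2)"
      by (rule sum_power_system)
    finally show "(\<Sum>js\<in>power_system n J. (\<Prod>i<n. u (js ! i))\<^sup>2) = 1"
      by (simp add: u_norm)
  qed (simp_all add: finite_power_system finite_A finite_B finite_J orthonormal_on_power_ket f g)
qed

context schmidt_decomposition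
begin

text \<open>Distributivity turns the product of \<open>n\<close> Schmidt sums into one sum over
  lists of indices; both operators vanish on lists of other lengths.\<close>

lemma psi_power:
  "bip_tensor_power n (ketbra psi) = ketbra (schmidt_decomposition.psi (power_system n J)
    (\<lambda>js. power_ket n (\<lambda>i. f (js ! i))) (\<lambda>js. power_ket n (\<lambda>i. g (js ! i))) (\<lambda>js. \<Prod>i<n. u (js ! i)))"
    (is "_ = ketbra ?psi")
proof -
  interpret power: schmidt_decomposition "power_system n A" "power_system n B" "power_system n J"
    "\<lambda>js. power_ket n (\<lambda>i. f (js ! i))" "\<lambda>js. power_ket n (\<lambda>i. g (js ! i))" "\<lambda>js. \<Prod>i<n. u (js ! i)"
    by (rule schmidt_decomposition_power[OF schmidt_decomposition_axioms])
  have "?psi (xs, ys) = (if length xs = n \<and> length ys = n then \<Prod>i<n. psi (xs ! i, ys ! i) else 0)" for xs ys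
  proof (cases "length xs = n \<and> length ys = n")
    case True
    then have "?psi (xs, ys) = (\<Sum>js\<in>power_system n J. \<Prod>i<n. of_real (u (js ! i)) * (f (js ! i) (xs ! i) * g (js ! i) (ys ! i)))"
      by (simp add: power.psi_def ket_tensor_def power_ket_def prod.distrib)
    also have "\<dots> = (\<Prod>i<n. psi (xs ! i, ys ! i))"
      by (simp add: psi_def ket_tensor_def sum_power_system[where I = J and h = "\<lambda>i j. of_real (u j) * (f j (xs ! i) * g j (ys ! i))"])
    finally show ?thesis using True by simp
  qed (auto simp: power.psi_def ket_tensor_def power_ket_def)
  then show ?thesis
    by (intro ext) (auto simp: bip_tensor_power_def ketbra_def prod.distrib)
qed

lemma S_power: "schmidt_decomposition.S (power_system n J) (\<lambda>js. \<Prod>i<n. u (js ! i)) = S ^ n"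
proof -
  interpret power: schmidt_decomposition "power_system n A" "power_system n B" "power_system n J"
    "\<lambda>js. power_ket n (\<lambda>i. f (js ! i))" "\<lambda>js. power_ket n (\<lambda>i. g (js ! i))" "\<lambda>js. \<Prod>i<n. u (js ! i)"
    by (rule schmidt_decomposition_power[OF schmidt_decomposition_axioms])
  show ?thesis
    by (simp add: power.S_def S_def sum_power_system[where I = J and h = "\<lambda>i. u"])
qed

text \<open>Summing over \<open>b\<close> is an inner product on \<open>B\<close>, which
  orthonormality of \<open>g\<close> makes diagonal. The result is a spectral decomposition of the
  reduced state.\<close>

lemma ptrace_B_psi: "ptrace_B B (ketbra psi) = (\<lambda>a a'. \<Sum>j\<in>J. of_real ((u j)\<^sup>2) * ketbra (f j) a a')"
proof (intro ext)
  fix a a'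
  have "ptrace_B B (ketbra psi) a a' = braket B (\<lambda>b. \<Sum>j\<in>J. (of_real (u j) * f j a') * g j b)
      (\<lambda>b. \<Sum>j\<in>J. (of_real (u j) * f j a) * g j b)"
    by (simp add: ptrace_B_def ketbra_def psi_def ket_tensor_def braket_def ac_simps)
  also have "\<dots> = (\<Sum>j\<in>J. of_real ((u j)\<^sup>2) * ketbra (f j) a a')"
    unfolding braket_orthonormal_sum[OF g finite_J] by (simp add: ketbra_def power2_eq_square ac_simps)
  finally show "ptrace_B B (ketbra psi) a a' = (\<Sum>j\<in>J. of_real ((u j)\<^sup>2) * ketbra (f j) a a')" .
qed

end

section \<open>Powers of operators\<close>

text \<open>Comparing two spectral decompositions, eigenvectors with nonzero overlap \<open>c m k\<close> have equal
  eigenvalues, so replacing eigenvalues by their powers preserves the equality.\<close>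

lemma spectral_power_unique:
  fixes l :: "'k \<Rightarrow> real" and l' :: "'m \<Rightarrow> real"
  assumes v: "orthonormal_on I K v" "finite K" "\<And>k. k \<in> K \<Longrightarrow> l k > 0"
    and w: "orthonormal_on I L w" "finite L" "\<And>m. m \<in> L \<Longrightarrow> l' m > 0"
    and eq: "(\<lambda>x y. \<Sum>k\<in>K. of_real (l k) * ketbra (v k) x y) = (\<lambda>x y. \<Sum>m\<in>L. of_real (l' m) * ketbra (w m) x y)"
  shows "(\<Sum>k\<in>K. of_real (l k powr \<alpha>) * ketbra (v k) x y) = (\<Sum>m\<in>L. of_real (l' m powr \<alpha>) * ketbra (w m) x y)"
proof -
  define c where "c m k = braket I (w m) (v k)" for m k
  have cnj_c: "braket I (v k) (w m) = cnj (c m k)" for m k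
    by (simp add: c_def flip: braket_commute)
  define M where "M = (\<lambda>x y. \<Sum>k\<in>K. of_real (l k) * ketbra (v k) x y)"
  have act: "(\<Sum>y\<in>I. (\<Sum>k\<in>K'. of_real (h k) * ketbra (e k) x y) * q y) = (\<Sum>k\<in>K'. of_real (h k) * braket I (e k) q * e k x)"
    for K' :: "'n set" and h and e :: "'n \<Rightarrow> _" and q x
    unfolding sum_distrib_right
    by (subst sum.swap) (simp add: braket_def ketbra_def sum_distrib_left sum_distrib_right ac_simps)
  have Mv: "(\<Sum>y\<in>I. M x y * v k y) = of_real (l k) * v k x" if "k \<in> K" for x k
  proof -
    have "(\<Sum>y\<in>I. M x y * v k y) = (\<Sum>j\<in>K. if j = k then of_real (l k) * v k x else 0)"
      unfolding M_def act using orthonormal_onD(2)[OF v(1)] that by (intro sum.cong) auto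
    then show ?thesis using v(2) that by simp
  qed
  have Mw: "(\<Sum>y\<in>I. M x y * w m y) = of_real (l' m) * w m x" if "m \<in> L" for x m
  proof -
    have "(\<Sum>y\<in>I. M x y * w m y) = (\<Sum>j\<in>L. if j = m then of_real (l' m) * w m x else 0)"
      unfolding M_def eq act using orthonormal_onD(2)[OF w(1)] that by (intro sum.cong) auto
    then show ?thesis using w(2) that by simp
  qed
  \<comment> \<open>Applying \<open>M\<close> to \<open>v k\<close> gives an eigenvalue multiple by
    one decomposition and a combination of the \<open>w m\<close> by the other.\<close>
  have v_expand: "of_real (l k) * v k x = (\<Sum>m\<in>L. (of_real (l' m) * c m k) * w m x)" if "k \<in> K" for k x
    unfolding Mv[OF that, symmetric] unfolding M_def eq act by (simp add: c_def)
  have w_expand: "of_real (l' m) * w m x = (\<Sum>k\<in>K. (of_real (l k) * cnj (c m k)) * v k x)" if "m \<in> L" for m x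
    unfolding Mw[OF that, symmetric] unfolding M_def act by (simp add: cnj_c)
  have overlap: "c m k = 0 \<or> l k = l' m" if "k \<in> K" "m \<in> L" for k m
  proof -
    have "of_real (l k) * c m k = braket I (w m) (\<lambda>x. of_real (l k) * v k x)"
      by (simp add: c_def braket_def sum_distrib_left ac_simps)
    also have "\<dots> = of_real (l' m) * c m k"
      unfolding v_expand[OF that(1)] by (rule braket_orthonormal_coeff[OF w(1,2) that(2)])
    finally show ?thesis by simp
  qed
  have comm: "of_real (h (l k)) * c m k = of_real (h (l' m)) * c m k"
    if "k \<in> K" "m \<in> L" for k m and h :: "real \<Rightarrow> real"
    using overlap[OF that] by auto
  \<comment> \<open>Terms with nonzero overlap have \<open>l' m = l k\<close>, so the positive
    eigenvalue cancels throughout.\<close>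
  have v_eq: "v k x = (\<Sum>m\<in>L. c m k * w m x)" if "k \<in> K" for k x
  proof -
    have "of_real (l k) * v k x = (\<Sum>m\<in>L. of_real (l k) * (c m k * w m x))"
      unfolding v_expand[OF that] using overlap[OF that] by (intro sum.cong refl) fastforce
    then have "of_real (l k) * v k x = of_real (l k) * (\<Sum>m\<in>L. c m k * w m x)"
      by (simp only: sum_distrib_left)
    with v(3)[OF that] show ?thesis by simp
  qed
  have w_eq: "w m x = (\<Sum>k\<in>K. cnj (c m k) * v k x)" if "m \<in> L" for m x
  proof -
    have "of_real (l' m) * w m x = (\<Sum>k\<in>K. of_real (l' m) * (cnj (c m k) * v k x))"
      unfolding w_expand[OF that] using overlap[OF _ that] by (intro sum.cong refl) fastforce
    then have "of_real (l' m) * w m x = of_real (l' m) * (\<Sum>k\<in>K. cnj (c m k) * v k x)"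
      by (simp only: sum_distrib_left)
    with w(3)[OF that] show ?thesis by simp
  qed
  have "(\<Sum>k\<in>K. of_real (l k powr \<alpha>) * ketbra (v k) x y) =
      (\<Sum>k\<in>K. \<Sum>m\<in>L. of_real (l k powr \<alpha>) * (c m k * w m x * cnj (v k y)))"
  proof (intro sum.cong refl)
    fix k assume "k \<in> K"
    then have "of_real (l k powr \<alpha>) * ketbra (v k) x y = of_real (l k powr \<alpha>) * ((\<Sum>m\<in>L. c m k * w m x) * cnj (v k y))"
      unfolding ketbra_def by (simp only: v_eq)
    then show "of_real (l k powr \<alpha>) * ketbra (v k) x y =
        (\<Sum>m\<in>L. of_real (l k powr \<alpha>) * (c m k * w m x * cnj (v k y)))"
      by (simp only: sum_distrib_left sum_distrib_right)
  qed
  \<comment> \<open>The powers are exchanged term by term through \<open>comm\<close>; the sum over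
    \<open>k\<close> then reassembles \<open>w m\<close>.\<close>
  also have "\<dots> = (\<Sum>m\<in>L. \<Sum>k\<in>K. of_real (l' m powr \<alpha>) * (w m x * (c m k * cnj (v k y))))"
    by (subst sum.swap, intro sum.cong refl)
      (use comm[of _ _ "\<lambda>r. r powr \<alpha>"] in \<open>simp add: mult.assoc[symmetric] mult.commute[of "w _ _"]\<close>)
  also have "\<dots> = (\<Sum>m\<in>L. of_real (l' m powr \<alpha>) * ketbra (w m) x y)"
  proof (intro sum.cong refl)
    fix m assume "m \<in> L"
    have "(\<Sum>k\<in>K. of_real (l' m powr \<alpha>) * (w m x * (c m k * cnj (v k y)))) =
        of_real (l' m powr \<alpha>) * (w m x * cnj (\<Sum>k\<in>K. cnj (c m k) * v k y))"
      by (simp add: sum_distrib_left)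
    then show "(\<Sum>k\<in>K. of_real (l' m powr \<alpha>) * (w m x * (c m k * cnj (v k y)))) = of_real (l' m powr \<alpha>) * ketbra (w m) x y"
      by (simp only: w_eq[OF \<open>m \<in> L\<close>, symmetric] ketbra_def)
  qed
  finally show ?thesis .
qed

lemma orthonormal_family_eq: "orthonormal_family I K v = orthonormal_on I K v"
  by (simp add: orthonormal_family_def orthonormal_on_def)

text \<open>The definite description is met by the given decomposition, and
  \<open>spectral_power_unique\<close> shows that any other one yields the same operator.\<close>

lemma op_powr_eq:
  fixes m :: nat
  assumes "orthonormal_on I {1..m} v" "\<And>k. k \<in> {1..m} \<Longrightarrow> l k > 0"
  shows "op_powr I (\<lambda>x y. \<Sum>k=1..m. of_real (l k) * ketbra (v k) x y) \<alpha> =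
    (\<lambda>x y. \<Sum>k=1..m. of_real (l k powr \<alpha>) * ketbra (v k) x y)"
  unfolding op_powr_def orthonormal_family_eq
proof (rule the_equality)
  fix X assume "\<exists>(n::nat) l' w. orthonormal_on I {1..n} w \<and> (\<forall>k\<in>{1..n}. l' k > 0) \<and>
     (\<lambda>x y. \<Sum>k=1..m. of_real (l k) * ketbra (v k) x y) = (\<lambda>x y. \<Sum>k=1..n. of_real (l' k) * ketbra (w k) x y) \<and>
     X = (\<lambda>x y. \<Sum>k=1..n. of_real (l' k powr \<alpha>) * ketbra (w k) x y)"
  then obtain n :: nat and l' w where *: "orthonormal_on I {1..n} w" "\<And>k. k \<in> {1..n} \<Longrightarrow> l' k > 0"
    "(\<lambda>x y. \<Sum>k=1..m. of_real (l k) * ketbra (v k) x y) = (\<lambda>x y. \<Sum>k=1..n. of_real (l' k) * ketbra (w k) x y)"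
    "X = (\<lambda>x y. \<Sum>k=1..n. of_real (l' k powr \<alpha>) * ketbra (w k) x y)"
    by blast
  show "X = (\<lambda>x y. \<Sum>k=1..m. of_real (l k powr \<alpha>) * ketbra (v k) x y)"
    unfolding *(4) by (intro ext spectral_power_unique[OF assms(1) _ assms(2) *(1) _ *(2,3), symmetric]) auto
qed (use assms in blast)

section \<open>Regularization\<close>

text \<open>On \<open>n\<close> copies \<open>S\<close> becomes \<open>S\<^sup>n\<close>, and the factor between \<open>2 S\<^sup>2\<^sup>n - 1\<close> and \<open>S\<^sup>2\<^sup>n\<close>, at most \<open>2\<close>,
  disappears under the \<open>n\<close>-th root.\<close>

lemma (in schmidt_decomposition) qp_extent_rate_psi:
  "qp_extent_rate A B (ketbra psi) n = root n (2 * (S\<^sup>2) ^ n - 1)"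
proof -
  interpret power: schmidt_decomposition "power_system n A" "power_system n B" "power_system n J"
    "\<lambda>js. power_ket n (\<lambda>i. f (js ! i))" "\<lambda>js. power_ket n (\<lambda>i. g (js ! i))" "\<lambda>js. \<Prod>i<n. u (js ! i)"
    by (rule schmidt_decomposition_power[OF schmidt_decomposition_axioms])
  show ?thesis
    by (simp add: qp_extent_rate_def psi_power power.qp_extent_psi S_power power_mult[symmetric] mult.commute)
qed

lemma (in schmidt_decomposition) tendsto_qp_extent_rate_psi:
  "qp_extent_rate A B (ketbra psi) \<longlonglongrightarrow> S\<^sup>2"
proof (rule tendsto_sandwich)
  \<comment> \<open>At \<open>n = 0\<close> the root is \<open>0\<close> by convention, hence below
    \<open>S\<^sup>2\<close>.\<close>
  have "S\<^sup>2 \<le> qp_extent_rate A B (ketbra psi) n" if "n > 0" for n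
  proof -
    have "S\<^sup>2 = root n ((S\<^sup>2) ^ n)"
      using that by (simp add: real_root_power_cancel)
    also have "\<dots> \<le> root n (2 * (S\<^sup>2) ^ n - 1)"
      using that one_le_power[OF one_le_S_squared, of n] by simp
    finally show ?thesis by (simp add: qp_extent_rate_psi)
  qed
  then show "\<forall>\<^sub>F n in sequentially. S\<^sup>2 \<le> qp_extent_rate A B (ketbra psi) n"
    by (auto simp: eventually_at_top_dense)
  have "qp_extent_rate A B (ketbra psi) n \<le> root n 2 * S\<^sup>2" if "n > 0" for n
  proof -
    have "qp_extent_rate A B (ketbra psi) n \<le> root n (2 * (S\<^sup>2) ^ n)"
      using that by (simp add: qp_extent_rate_psi)
    also have "\<dots> = root n 2 * S\<^sup>2"
      using that by (simp add: real_root_mult real_root_power_cancel)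
    finally show ?thesis .
  qed
  then show "\<forall>\<^sub>F n in sequentially. qp_extent_rate A B (ketbra psi) n \<le> root n 2 * S\<^sup>2"
    by (auto simp: eventually_at_top_dense)
  show "(\<lambda>n. root n 2 * S\<^sup>2) \<longlonglongrightarrow> S\<^sup>2"
    using tendsto_mult[OF LIMSEQ_root_const[of 2] tendsto_const[of "S\<^sup>2"]] by simp
qed simp

theorem corollary5p16:
  fixes A :: "'a set" and B :: "'b set"
    and \<psi> :: "('a \<times> 'b) ket" and r :: nat and u :: "nat \<Rightarrow> real"
  assumes "finite A" and "finite B"
    and "pure_state (A \<times> B) \<psi>"
    and "schmidt_coefficients A B \<psi> r u"
  shows "convergent (qp_extent_rate A B (ketbra \<psi>)) \<and>
    (\<exists>t. robustness_feasible A B (ketbra \<psi>) t \<and>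
         (\<forall>s. robustness_feasible A B (ketbra \<psi>) s \<longrightarrow> t \<le> s)) \<and>
    reg_qp_extent A B (ketbra \<psi>) = 1 + robustness A B (ketbra \<psi>) \<and>
    1 + robustness A B (ketbra \<psi>) = (\<Sum>j=1..r. u j)\<^sup>2 \<and>
    (\<Sum>j=1..r. u j)\<^sup>2 = 2 powr renyi_entropy A (1/2) (ptrace_B B (ketbra \<psi>))"
proof -
  obtain f g where f: "orthonormal_on A {1..r} f" and g: "orthonormal_on B {1..r} g"
    and u: "\<And>j. j \<in> {1..r} \<Longrightarrow> u j > 0"
    and \<psi>: "\<psi> = (\<lambda>x. \<Sum>j=1..r. of_real (u j) * ket_tensor (f j) (g j) x)"
    using assms(4) unfolding schmidt_coefficients_def orthonormal_family_eq
    by (auto simp: ket_tensor_def split_def mult.assoc)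
  have "braket (A \<times> B) \<psi> \<psi> = of_real (\<Sum>j=1..r. (u j)\<^sup>2)"
    unfolding \<psi> braket_orthonormal_sum[OF orthonormal_on_ket_tensor[OF f g] finite_atLeastAtMost]
    by (simp add: power2_eq_square)
  then have norm: "(\<Sum>j=1..r. (u j)\<^sup>2) = 1"
    using assms(3) by (simp add: pure_state_def flip: of_real_sum of_real_power)
  interpret schmidt_decomposition A B "{1..r}" f g u
    by unfold_locales (use assms f g u norm in auto)
  have psi: "\<psi> = psi" unfolding \<psi> psi_def ..
  \<comment> \<open>The reduced state has the squared Schmidt coefficients as its positive
    eigenvalues, so its square root has trace \<open>S\<close>; the prefactor
    \<open>1 / (1 - 1/2) = 2\<close> of the entropy then squares it.\<close>
  have "op_powr A (ptrace_B B (ketbra psi)) (1/2) =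
      (\<lambda>x y. \<Sum>j=1..r. of_real (((u j)\<^sup>2) powr (1/2)) * ketbra (f j) x y)"
    unfolding ptrace_B_psi by (rule op_powr_eq[OF f]) (use u in force)
  moreover have "op_trace A (ketbra (f j)) = 1" if "j \<in> {1..r}" for j
    using orthonormal_onD[OF f] that density_op_ketbra[of A "f j"] by (simp add: density_op_def)
  moreover have "((u j)\<^sup>2) powr (1/2) = u j" if "j \<in> {1..r}" for j
    using u[OF that] by (simp add: powr_half_sqrt)
  ultimately have "op_trace A (op_powr A (ptrace_B B (ketbra psi)) (1/2)) = of_real S"
    by (simp add: op_trace_sum S_def del: One_nat_def)
  then have "renyi_entropy A (1/2) (ptrace_B B (ketbra psi)) = 2 * log 2 S"
    by (simp add: renyi_entropy_def)
  also have "\<dots> = log 2 (S\<^sup>2)"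
    using S_pos by (simp add: log_nat_power)
  finally have "S\<^sup>2 = 2 powr renyi_entropy A (1/2) (ptrace_B B (ketbra psi))"
    using S_pos by simp
  moreover have "reg_qp_extent A B (ketbra psi) = S\<^sup>2" "convergent (qp_extent_rate A B (ketbra psi))"
    unfolding reg_qp_extent_def using tendsto_qp_extent_rate_psi by (auto intro: limI convergentI)
  moreover have "1 + robustness A B (ketbra psi) = S\<^sup>2"
    by (simp only: robustness_psi)
  ultimately show ?thesis
    unfolding psi S_def[symmetric] using robustness_feasible_psi robustness_feasible_psi_le by metis
qed

end
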